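(* Let $\Lambda$ be a locally finite connected (simple, undirected) graph and let $\Gamma \leq \mathrm{Aut}(\Lambda)$ act cocompactly on $\Lambda$. Let $H_n \to H$ be a converging sequence in $\mathbf{Sub}(\mathrm{Aut}(\Lambda))$. Suppose that for each $n\geq 1$ there exists $\tau_n\in \mathrm{Aut}(\Lambda)$ such that $\tau_n\Gamma\tau_n^{-1}\leq H_n$. Then $$[H:H^{(\infty)}]\leq \limsup_{n\to\infty}\,[H_n:H_n^{(\infty)}].$$ In particular, the set $\{H\in \mathbf{Sub}(\mathrm{Aut}(\Lambda)) \mid H\geq \Gamma \text{ and } H=H^{(\infty)}\}$ is closed in $\mathbf{Sub}(\mathrm{Aut}(\Lambda))$.
   Context: $\mathrm{Aut}(\Lambda)$ carries the topology of pointwise convergence on vertices; it is a second countable totally disconnected locally compact group. A group acts cocompactly on $\Lambda$ if it has finitely many orbits of vertices (equivalently, a compact fundamental domain). For a locally compact group $G$, $\mathbf{Sub}(G)$ is the set of closed subgroups of $G$ with the (compact Hausdorff) Chabauty topology, in which a base of neighborhoods of $H$ is given by the sets $\{J \in \mathbf{Sub}(G) \mid J\cap K\subseteq HU,\ H\cap K\subseteq JU\}$ with $K\subseteq G$ compact and $U$ an open identity neighborhood. For a topological group $H$, $H^{(\infty)}$ denotes the intersection of all open subgroups of finite index of $H$. Indices take values in $\{1,2,\dots\}\cup\{\infty\}$. *)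

theory Defs
  imports "HOL-Algebra.Algebra" "HOL-Analysis.Analysis"
    "HOL-Library.Extended_Nat" "HOL-Library.Liminf_Limsup"
begin

section \<open>Index and residual of a topological group\<close>

text \<open>A topological group is given by a group \<open>G\<close> of \<open>HOL-Algebra\<close> together with a topology \<open>T\<close>
  whose underlying set is \<open>carrier G\<close>.\<close>

definition finite_index :: "('a, 'b) monoid_scheme \<Rightarrow> 'a set \<Rightarrow> bool" where
  "finite_index G N \<longleftrightarrow> finite (rcosets\<^bsub>G\<^esub> N)"

definition group_index :: "('a, 'b) monoid_scheme \<Rightarrow> 'a set \<Rightarrow> enat" where
  "group_index G N = (if finite_index G N then enat (card (rcosets\<^bsub>G\<^esub> N)) else \<infinity>)"

text \<open>The group \<open>H\<^sup>(\<^sup>\<infinity>\<^sup>)\<close>. The family intersected contains \<open>carrier G\<close>, so it is never empty.\<close>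

definition residual :: "('a, 'b) monoid_scheme \<Rightarrow> 'a topology \<Rightarrow> 'a set" where
  "residual G T = \<Inter>{N. subgroup N G \<and> openin T N \<and> finite_index G N}"

text \<open>The same for a subgroup \<open>H\<close> of \<open>G\<close>, which carries the subspace topology.\<close>

definition sub_residual :: "('a, 'b) monoid_scheme \<Rightarrow> 'a topology \<Rightarrow> 'a set \<Rightarrow> 'a set" where
  "sub_residual G T H = residual (G\<lparr>carrier := H\<rparr>) (subtopology T H)"

definition sub_residual_index :: "('a, 'b) monoid_scheme \<Rightarrow> 'a topology \<Rightarrow> 'a set \<Rightarrow> enat" where
  "sub_residual_index G T H = group_index (G\<lparr>carrier := H\<rparr>) (sub_residual G T H)"

section \<open>The Chabauty space\<close>

definition Sub :: "('a, 'b) monoid_scheme \<Rightarrow> 'a topology \<Rightarrow> 'a set set" where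
  "Sub G T = {H. subgroup H G \<and> closedin T H}"

definition chabauty_nbhd ::
    "('a, 'b) monoid_scheme \<Rightarrow> 'a topology \<Rightarrow> 'a set \<Rightarrow> 'a set \<Rightarrow> 'a set \<Rightarrow> 'a set set" where
  "chabauty_nbhd G T H K U =
     {J \<in> Sub G T. J \<inter> K \<subseteq> H <#>\<^bsub>G\<^esub> U \<and> H \<inter> K \<subseteq> J <#>\<^bsub>G\<^esub> U}"

text \<open>A family of closed subgroups is open iff with each \<open>H\<close> it contains one of the prescribed basic
  neighbourhoods of \<open>H\<close>; this is the only topology for which these sets can form neighbourhood bases.\<close>

definition chabauty_open :: "('a, 'b) monoid_scheme \<Rightarrow> 'a topology \<Rightarrow> 'a set set \<Rightarrow> bool" where
  "chabauty_open G T \<U> \<longleftrightarrow> \<U> \<subseteq> Sub G T \<and>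
     (\<forall>H\<in>\<U>. \<exists>K U. compactin T K \<and> openin T U \<and> \<one>\<^bsub>G\<^esub> \<in> U \<and> chabauty_nbhd G T H K U \<subseteq> \<U>)"

definition chabauty :: "('a, 'b) monoid_scheme \<Rightarrow> 'a topology \<Rightarrow> 'a set topology" where
  "chabauty G T = topology (chabauty_open G T)"

lemma chabauty_nbhd_mono:
  assumes "K \<subseteq> K'" "U' \<subseteq> U"
  shows "chabauty_nbhd G T H K' U' \<subseteq> chabauty_nbhd G T H K U"
proof
  have m: "A <#>\<^bsub>G\<^esub> U' \<subseteq> A <#>\<^bsub>G\<^esub> U" for A
    using assms(2) by (auto simp: set_mult_def)
  fix J assume "J \<in> chabauty_nbhd G T H K' U'"
  then have "J \<in> Sub G T" "J \<inter> K' \<subseteq> H <#>\<^bsub>G\<^esub> U'" "H \<inter> K' \<subseteq> J <#>\<^bsub>G\<^esub> U'"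
    by (auto simp: chabauty_nbhd_def)
  then show "J \<in> chabauty_nbhd G T H K U"
    using m[of H] m[of J] assms(1) unfolding chabauty_nbhd_def by blast
qed

lemma istopology_chabauty_open: "istopology (chabauty_open G T)"
  unfolding istopology_def
proof (intro conjI allI impI)
  fix \<U> \<V> assume o: "chabauty_open G T \<U>" "chabauty_open G T \<V>"
  show "chabauty_open G T (\<U> \<inter> \<V>)"
    unfolding chabauty_open_def
  proof (intro conjI ballI)
    show "\<U> \<inter> \<V> \<subseteq> Sub G T" using o by (auto simp: chabauty_open_def)
    fix H assume H: "H \<in> \<U> \<inter> \<V>"
    obtain K U where 1: "compactin T K" "openin T U" "\<one>\<^bsub>G\<^esub> \<in> U" "chabauty_nbhd G T H K U \<subseteq> \<U>"
      using o(1) H unfolding chabauty_open_def by blast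
    obtain L V where 2: "compactin T L" "openin T V" "\<one>\<^bsub>G\<^esub> \<in> V" "chabauty_nbhd G T H L V \<subseteq> \<V>"
      using o(2) H unfolding chabauty_open_def by blast
    have "chabauty_nbhd G T H (K \<union> L) (U \<inter> V) \<subseteq> \<U> \<inter> \<V>"
      using chabauty_nbhd_mono[of K "K \<union> L" "U \<inter> V" U G T H]
        chabauty_nbhd_mono[of L "K \<union> L" "U \<inter> V" V G T H] 1(4) 2(4) by blast
    then show "\<exists>K U. compactin T K \<and> openin T U \<and> \<one>\<^bsub>G\<^esub> \<in> U \<and> chabauty_nbhd G T H K U \<subseteq> \<U> \<inter> \<V>"
      using 1 2 by (intro exI[of _ "K \<union> L"] exI[of _ "U \<inter> V"]) (auto intro: compactin_Un)
  qed
next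
  fix \<K> assume a: "\<forall>\<U>\<in>\<K>. chabauty_open G T \<U>"
  show "chabauty_open G T (\<Union> \<K>)"
    unfolding chabauty_open_def
  proof (intro conjI ballI)
    show "\<Union> \<K> \<subseteq> Sub G T"
    proof (rule Union_least)
      fix \<U> assume "\<U> \<in> \<K>"
      with a have "chabauty_open G T \<U>" by (rule bspec)
      then show "\<U> \<subseteq> Sub G T" by (simp add: chabauty_open_def)
    qed
    fix H assume "H \<in> \<Union> \<K>"
    then obtain \<U> where u: "\<U> \<in> \<K>" "H \<in> \<U>" by (rule UnionE)
    from a u(1) have "chabauty_open G T \<U>" by (rule bspec)
    with u(2) obtain K U where
      k: "compactin T K" "openin T U" "\<one>\<^bsub>G\<^esub> \<in> U" "chabauty_nbhd G T H K U \<subseteq> \<U>"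
      unfolding chabauty_open_def by blast
    have "chabauty_nbhd G T H K U \<subseteq> \<Union> \<K>"
      using k(4) Union_upper[OF u(1)] by (rule order_trans)
    with k show "\<exists>K U. compactin T K \<and> openin T U \<and> \<one>\<^bsub>G\<^esub> \<in> U \<and> chabauty_nbhd G T H K U \<subseteq> \<Union> \<K>"
      by blast
  qed
qed

lemma openin_chabauty: "openin (chabauty G T) = chabauty_open G T"
  unfolding chabauty_def by (rule topology_inverse'[OF istopology_chabauty_open])

lemma topspace_chabauty: "topspace (chabauty G T) = Sub G T"
proof -
  have "chabauty_open G T (Sub G T)"
    unfolding chabauty_open_def
  proof (intro conjI ballI)
    fix H assume "H \<in> Sub G T"
    then have s: "subgroup H G" "closedin T H" by (auto simp: Sub_def)
    then have "\<one>\<^bsub>G\<^esub> \<in> topspace T"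
      using closedin_subset subgroup.one_closed by blast
    then show "\<exists>K U. compactin T K \<and> openin T U \<and> \<one>\<^bsub>G\<^esub> \<in> U \<and> chabauty_nbhd G T H K U \<subseteq> Sub G T"
      by (intro exI[of _ "{}"] exI[of _ "topspace T"]) (auto simp: chabauty_nbhd_def)
  qed simp
  then show ?thesis
    unfolding topspace_def openin_chabauty
    by (intro subset_antisym Union_least Union_upper) (simp_all add: chabauty_open_def)
qed

section \<open>Graphs and their automorphism groups\<close>

text \<open>A graph is given by its adjacency relation; its vertex set is the whole (arbitrary) type.\<close>

definition simple_graph :: "('v \<Rightarrow> 'v \<Rightarrow> bool) \<Rightarrow> bool" where
  "simple_graph E \<longleftrightarrow> symp E \<and> irreflp E"

definition locally_finite_graph :: "('v \<Rightarrow> 'v \<Rightarrow> bool) \<Rightarrow> bool" where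
  "locally_finite_graph E \<longleftrightarrow> (\<forall>v. finite {w. E v w})"

definition connected_graph :: "('v \<Rightarrow> 'v \<Rightarrow> bool) \<Rightarrow> bool" where
  "connected_graph E \<longleftrightarrow> (\<forall>v w. E\<^sup>*\<^sup>* v w)"

definition Aut :: "('v \<Rightarrow> 'v \<Rightarrow> bool) \<Rightarrow> ('v \<Rightarrow> 'v) monoid" where
  "Aut E = \<lparr>carrier = {f. bij f \<and> (\<forall>v w. E (f v) (f w) \<longleftrightarrow> E v w)}, monoid.mult = (\<circ>), one = id\<rparr>"

text \<open>Pointwise convergence on vertices: the subspace topology from the product of discrete spaces.\<close>

definition Aut_top :: "('v \<Rightarrow> 'v \<Rightarrow> bool) \<Rightarrow> ('v \<Rightarrow> 'v) topology" where
  "Aut_top E = subtopology (product_topology (\<lambda>_. discrete_topology UNIV) UNIV) (carrier (Aut E))"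

definition acts_cocompactly :: "('v \<Rightarrow> 'v) set \<Rightarrow> ('v \<Rightarrow> 'v \<Rightarrow> bool) \<Rightarrow> bool" where
  "acts_cocompactly \<Gamma> E \<longleftrightarrow> finite (orbits (Aut E\<lparr>carrier := \<Gamma>\<rparr>) UNIV (\<lambda>g. g))"

lemma group_Aut: "group (Aut E)"
proof (rule groupI)
  fix f assume f: "f \<in> carrier (Aut E)"
  then have b: "bij f" by (simp add: Aut_def)
  have "inv_into UNIV f \<in> carrier (Aut E)"
  proof -
    have "E (inv_into UNIV f v) (inv_into UNIV f w) \<longleftrightarrow> E v w" for v w
    proof -
      have "f (inv_into UNIV f v) = v" "f (inv_into UNIV f w) = w"
        using b by (simp_all add: bij_is_surj surj_f_inv_f)
      moreover have "E (f (inv_into UNIV f v)) (f (inv_into UNIV f w))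
          \<longleftrightarrow> E (inv_into UNIV f v) (inv_into UNIV f w)"
        using f by (simp add: Aut_def)
      ultimately show ?thesis by simp
    qed
    then show ?thesis using b by (simp add: Aut_def bij_imp_bij_inv)
  qed
  moreover have "inv_into UNIV f \<circ> f = id" using b by (simp add: bij_is_inj)
  ultimately show "\<exists>g\<in>carrier (Aut E). g \<otimes>\<^bsub>Aut E\<^esub> f = \<one>\<^bsub>Aut E\<^esub>"
    by (auto simp: Aut_def)
qed (simp_all add: Aut_def bij_comp comp_assoc)

lemma topspace_Aut_top: "topspace (Aut_top E) = carrier (Aut E)"
  by (simp add: Aut_top_def)

end

(* Let N be an open subgroup of finite index of H and let H act on its cosets by phi. For n large,
   every s in H_n of bounded displacement agrees on a large ball with some s' in H, so that
   psi(s) := phi(s') is a well-defined local homomorphism. In general it need not extend to H_n, as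
   the relations of H_n may be arbitrarily long; but phi is a genuine homomorphism on the cocompact
   subgroup Gamma, and every element of H_n is g s with g in Gamma and s of bounded displacement.
   So phi(g) psi(s) is well defined, and it is multiplicative because Gamma is generated by
   elements of bounded displacement. Its kernel is open in H_n and its image is phi(H), which gives
   [H : N] <= [H_n : H_n^(infinity)]. The conjugating elements tau_n may be multiplied by elements of
   Gamma so that they stay in a compact set, and so accumulate at some tau; the conjugates of Gamma
   by tau_n and by tau then differ by elements close to the identity. *)

theory Submission
  imports Defs
begin


section \<open>Index\<close>

text \<open>The residual is handled one \<open>N\<close> at a time: if the indices of the open
  subgroups of finite index are bounded, one of maximal index is contained in all the others and is
  the residual. So each \<open>N\<close> may have its own Chabauty neighbourhood of H on which the
  index is at least [H : N]. All estimates are radii around one vertex. Composing with an inner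
  factor of displacement m costs m in the radius of agreement. Orbits of Gamma are R-dense, with the
  same R for all conjugates, so a radius depending only on R and on a ball whose pointwise
  stabilizer in H acts trivially on the cosets of N is enough, however long the elements of Gamma
  are. The neighbourhood statement, with trivial conjugator, also shows that the complement of the
  set in the second claim is open.\<close>

lemma group_index_eq_enatD:
  assumes "group_index G N = enat m"
  shows "finite (rcosets\<^bsub>G\<^esub> N)" "card (rcosets\<^bsub>G\<^esub> N) = m"
  using assms by (auto simp: group_index_def finite_index_def split: if_splits)

lemma (in group) finite_index_Int:
  assumes "subgroup M G" "subgroup N G" "finite_index G M" "finite_index G N"
  shows "finite_index G (M \<inter> N)"
proof -
  have "rcosets (M \<inter> N) \<subseteq> (\<lambda>(A, B). A \<inter> B) ` ((rcosets M) \<times> (rcosets N))"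
  proof
    fix C assume "C \<in> rcosets (M \<inter> N)"
    then obtain a where a: "a \<in> carrier G" "C = (M \<inter> N) #> a" by (auto simp: RCOSETS_def)
    have s: "M \<subseteq> carrier G" "N \<subseteq> carrier G" using assms(1,2) by (auto simp: subgroup.subset)
    have "x \<in> C" if "x \<in> M #> a" "x \<in> N #> a" for x
    proof -
      from that obtain m n where mn: "m \<in> M" "n \<in> N" "x = m \<otimes> a" "x = n \<otimes> a"
        by (auto simp: r_coset_def)
      then have "m = n" using s a(1) by (metis r_cancel subsetD)
      with mn a(2) show ?thesis by (auto simp: r_coset_def)
    qed
    then have "C = (M #> a) \<inter> (N #> a)"
      using a by (auto simp: r_coset_def)
    moreover have "M #> a \<in> rcosets M" "N #> a \<in> rcosets N" using a by (auto simp: RCOSETS_def)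
    ultimately show "C \<in> (\<lambda>(A, B). A \<inter> B) ` ((rcosets M) \<times> (rcosets N))" by force
  qed
  with assms(3,4) show ?thesis unfolding finite_index_def by (metis finite_SigmaI finite_imageI finite_subset)
qed

text \<open>The map \<open>C \<mapsto> N <#> C\<close> sends the cosets of \<open>M\<close> onto
  those of \<open>N\<close>, hence is injective by counting. All \<open>M #> n\<close> with
  \<open>n\<close> in \<open>N\<close> have image \<open>N\<close>, so they coincide with
  \<open>M\<close>.\<close>

lemma (in group) subgroup_eq_of_card_rcosets_le:
  assumes "subgroup M G" "subgroup N G" "M \<subseteq> N" "finite_index G M"
    and le: "card (rcosets M) \<le> card (rcosets N)"
  shows "M = N"
proof -
  let ?f = "\<lambda>C. N <#> C"
  have sub: "M \<subseteq> carrier G" "N \<subseteq> carrier G" using assms(1,2) by (auto simp: subgroup.subset)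
  have NM: "N <#> M = N"
  proof
    show "N <#> M \<subseteq> N" using assms(2,3) by (auto simp: set_mult_def subgroup.m_closed)
    show "N \<subseteq> N <#> M"
    proof
      fix n assume "n \<in> N"
      moreover from this have "n = n \<otimes> \<one>" using sub by auto
      ultimately show "n \<in> N <#> M"
        using subgroup.one_closed[OF assms(1)] unfolding set_mult_def by blast
    qed
  qed
  have f: "?f (M #> a) = N #> a" if "a \<in> carrier G" for a
    using that sub NM by (simp add: setmult_rcos_assoc)
  have im: "?f ` (rcosets M) = rcosets N"
    using f by (auto simp: RCOSETS_def image_UN)
  have fin: "finite (rcosets M)" using assms(4) by (simp add: finite_index_def)
  then have "inj_on ?f (rcosets M)"
    by (metis card_image_le eq_card_imp_inj_on im le le_antisym)
  moreover have "M #> n = M #> \<one>" if "n \<in> N" "inj_on ?f (rcosets M)" for n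
  proof -
    have n: "n \<in> carrier G" using that sub by auto
    have "?f (M #> n) = ?f (M #> \<one>)"
      using f[OF n] f[of \<one>] coset_join2[OF n assms(2) that(1)] sub by simp
    then show ?thesis using that(2) n unfolding inj_on_def by (auto simp: RCOSETS_def)
  qed
  ultimately have "n \<in> M" if "n \<in> N" for n
    using that assms(1) sub by (metis coset_mult_one rcos_self subsetD)
  with assms(3) show ?thesis by auto
qed

text \<open>Such an \<open>f\<close> factors through the cosets of \<open>M\<close>. Later
  \<open>f\<close> is a homomorphism and \<open>M\<close> the residual.\<close>

lemma card_image_le_group_index:
  fixes G (structure)
  assumes "group G" "subgroup M G"
    and f: "\<And>r x. r \<in> M \<Longrightarrow> x \<in> carrier G \<Longrightarrow> f (r \<otimes>\<^bsub>G\<^esub> x) = f x"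
  shows "enat (card (f ` carrier G)) \<le> group_index G M"
proof (cases "finite_index G M")
  case True
  interpret group G by fact
  have fin: "finite (rcosets M)" using True by (simp add: finite_index_def)
  have "f ` carrier G \<subseteq> (\<lambda>C. f (SOME c. c \<in> C)) ` (rcosets M)"
  proof
    fix q assume "q \<in> f ` carrier G"
    then obtain x where x: "x \<in> carrier G" "q = f x" by auto
    have "x \<in> M #> x" using x assms(2) by (simp add: rcos_self)
    then have "(SOME c. c \<in> M #> x) \<in> M #> x" by (rule someI)
    then have "f (SOME c. c \<in> M #> x) = q" using f x by (auto simp: r_coset_def)
    moreover have "M #> x \<in> rcosets M" using x by (auto simp: RCOSETS_def)
    ultimately show "q \<in> (\<lambda>C. f (SOME c. c \<in> C)) ` (rcosets M)" by blast
  qed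
  then have "card (f ` carrier G) \<le> card (rcosets M)" using fin by (rule surj_card_le[rotated])
  then show ?thesis using True by (simp add: group_index_def)
qed (simp add: group_index_def)

lemma (in group) rcosets_carrier: "rcosets (carrier G) = {carrier G}"
  using subgroup_self by (auto simp: RCOSETS_def coset_join2)

lemma (in group) group_index_carrier: "group_index G (carrier G) = 1"
  by (simp add: group_index_def finite_index_def one_enat_def rcosets_carrier)

section \<open>Residual\<close>

definition open_finite_index :: "('a, 'b) monoid_scheme \<Rightarrow> 'a topology \<Rightarrow> 'a set \<Rightarrow> bool" where
  "open_finite_index G T N \<longleftrightarrow> subgroup N G \<and> openin T N \<and> finite_index G N"

lemma residual_eq: "residual G T = \<Inter>{N. open_finite_index G T N}"
  by (simp add: residual_def open_finite_index_def)

lemma open_finite_index_carrier: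
  fixes G (structure)
  assumes "group G" "topspace T = carrier G"
  shows "open_finite_index G T (carrier G)"
proof -
  interpret group G by fact
  have "openin T (carrier G)" using openin_topspace[of T] assms(2) by simp
  then show ?thesis
    using subgroup_self by (simp add: open_finite_index_def finite_index_def rcosets_carrier)
qed

lemma subgroup_residual:
  assumes "group G" "topspace T = carrier G"
  shows "subgroup (residual G T) G"
  unfolding residual_eq using open_finite_index_carrier[OF assms]
  by (intro group.subgroups_Inter[OF assms(1)]) (auto simp: open_finite_index_def)

text \<open>Bounded indices have a maximum, attained at some \<open>N\<close>. For \<open>N'\<close>
  in the family, \<open>N \<inter> N'\<close> is again in it and of index at most that of
  \<open>N\<close>, hence equals \<open>N\<close>; so \<open>N\<close> is the residual.\<close>

lemma group_index_residual_le:
  fixes G (structure)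
  assumes G: "group G" "topspace T = carrier G"
    and le: "\<And>N. open_finite_index G T N \<Longrightarrow> enat (card (rcosets\<^bsub>G\<^esub> N)) \<le> c"
  shows "group_index G (residual G T) \<le> c"
proof (cases c)
  case (enat m)
  interpret group G by fact
  let ?P = "open_finite_index G T" and ?i = "\<lambda>N. card (rcosets N)"
  define M where "M = Max (?i ` Collect ?P)"
  have b: "?i ` Collect ?P \<subseteq> {..m}" using le enat by auto
  then have fin: "finite (?i ` Collect ?P)" by (rule finite_subset) simp
  moreover have "?i ` Collect ?P \<noteq> {}" using open_finite_index_carrier[OF G] by auto
  ultimately have "M \<in> ?i ` Collect ?P" unfolding M_def by (rule Max_in)
  then obtain N where N: "?P N" "?i N = M" by auto
  have "N \<subseteq> N'" if N': "?P N'" for N'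
  proof -
    have PI: "?P (N \<inter> N')"
      using N N' by (auto simp: open_finite_index_def finite_index_Int subgroups_Inter_pair)
    then have "?i (N \<inter> N') \<le> M" unfolding M_def using fin by (intro Max_ge) auto
    then have "N \<inter> N' = N"
      using PI N by (intro subgroup_eq_of_card_rcosets_le) (auto simp: open_finite_index_def)
    then show ?thesis by auto
  qed
  then have "residual G T = N" using N(1) unfolding residual_eq by auto
  then show ?thesis using N(1) le by (simp add: group_index_def open_finite_index_def)
qed simp

section \<open>Balls\<close>

primrec gball :: "('v \<Rightarrow> 'v \<Rightarrow> bool) \<Rightarrow> nat \<Rightarrow> 'v \<Rightarrow> 'v set" where
  "gball E 0 v = {v}"
| "gball E (Suc n) v = gball E n v \<union> {w. \<exists>x\<in>gball E n v. E x w}"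

abbreviation iv :: "('v \<Rightarrow> 'v) \<Rightarrow> 'v \<Rightarrow> 'v" where "iv \<equiv> inv_into UNIV"

lemma mult_Aut [simp]: "f \<otimes>\<^bsub>Aut E\<^esub> g = f \<circ> g"
  and one_Aut [simp]: "\<one>\<^bsub>Aut E\<^esub> = id"
  by (simp_all add: Aut_def)

lemma Aut_bij: "f \<in> carrier (Aut E) \<Longrightarrow> bij f"
  by (simp add: Aut_def)

lemma Aut_iff: "f \<in> carrier (Aut E) \<Longrightarrow> E (f v) (f w) \<longleftrightarrow> E v w"
  by (simp add: Aut_def)

lemma iv_apply [simp]:
  assumes "f \<in> carrier (Aut E)"
  shows "f (iv f x) = x" "iv f (f x) = x" "f \<circ> iv f = id" "iv f \<circ> f = id"
  using Aut_bij[OF assms] by (auto simp: bij_is_surj surj_f_inv_f bij_is_inj surj_iff)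

lemma inv_Aut:
  assumes f: "f \<in> carrier (Aut E)"
  shows "iv f \<in> carrier (Aut E)" "inv\<^bsub>Aut E\<^esub> f = iv f"
proof -
  have "E (iv f v) (iv f w) \<longleftrightarrow> E v w" for v w
    using Aut_iff[OF f, of "iv f v" "iv f w"] f by simp
  then show "iv f \<in> carrier (Aut E)"
    using Aut_bij[OF f] by (simp add: Aut_def bij_imp_bij_inv)
  then show "inv\<^bsub>Aut E\<^esub> f = iv f"
    using f by (intro group.inv_equality[OF group_Aut]) simp_all
qed

lemma comp_Aut: "f \<in> carrier (Aut E) \<Longrightarrow> g \<in> carrier (Aut E) \<Longrightarrow> f \<circ> g \<in> carrier (Aut E)"
  using monoid.m_closed[OF group.is_monoid[OF group_Aut], of f E g] by simp

lemma subgroup_AutD: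
  assumes "subgroup H (Aut E)"
  shows "id \<in> H" "f \<in> H \<Longrightarrow> g \<in> H \<Longrightarrow> f \<circ> g \<in> H" "f \<in> H \<Longrightarrow> iv f \<in> H"
    "f \<in> H \<Longrightarrow> f \<in> carrier (Aut E)"
  using subgroup.one_closed[OF assms] subgroup.m_closed[OF assms, of f g]
    subgroup.m_inv_closed[OF assms, of f] subgroup.mem_carrier[OF assms, of f]
    by (auto simp: inv_Aut)

text \<open>The vertex \<open>p\<close> is an arbitrary base point, from which radii and
  displacements are measured.\<close>

locale lf_graph =
  fixes E :: "'v \<Rightarrow> 'v \<Rightarrow> bool" and p :: 'v
  assumes sym: "E v w \<Longrightarrow> E w v" and lf: "finite {w. E v w}" and conn: "E\<^sup>*\<^sup>* v w"
begin

abbreviation "B \<equiv> gball E"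
abbreviation "A \<equiv> carrier (Aut E)"

lemma self_in_B [simp]: "v \<in> B n v" by (induction n) auto

lemma B_trans: "y \<in> B n x \<Longrightarrow> x \<in> B m v \<Longrightarrow> y \<in> B (m + n) v"
  by (induction n arbitrary: y) auto

lemma B_mono: "m \<le> n \<Longrightarrow> x \<in> B m v \<Longrightarrow> x \<in> B n v"
  using B_trans[of x "n - m" x m v] by simp

lemma B_sym: "w \<in> B n v \<Longrightarrow> v \<in> B n w"
proof (induction n arbitrary: w)
  case (Suc n)
  show ?case
  proof (cases "w \<in> B n v")
    case True
    then show ?thesis using Suc.IH by auto
  next
    case False
    then obtain x where x: "x \<in> B n v" "E x w" using Suc.prems by auto
    then have "x \<in> B 1 w" using sym by auto
    then show ?thesis using B_trans[OF Suc.IH[OF x(1)], of 1 w] by simp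
  qed
qed simp

lemma finite_B: "finite (B n v)"
proof (induction n)
  case (Suc n)
  have "{w. \<exists>x\<in>B n v. E x w} = (\<Union>x\<in>B n v. {w. E x w})" by auto
  then show ?case using Suc lf by simp
qed simp

lemma B_exhaust: "\<exists>n. w \<in> B n v"
proof -
  have "E\<^sup>*\<^sup>* v w" by (rule conn)
  then show ?thesis
  proof (induction rule: rtranclp_induct)
    case (step y z)
    then obtain n where "y \<in> B n v" by auto
    then have "z \<in> B (Suc n) v" using step by auto
    then show ?case ..
  qed (auto intro: exI[of _ 0])
qed

lemma finite_subset_B: "finite F \<Longrightarrow> \<exists>n. F \<subseteq> B n v"
proof (induction F rule: finite_induct)
  case (insert x F)
  then obtain n m where "F \<subseteq> B n v" "x \<in> B m v" using B_exhaust by blast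
  then have "insert x F \<subseteq> B (max n m) v"
    using B_mono[of n "max n m"] B_mono[of m "max n m"] by auto
  then show ?case ..
qed simp

lemma Aut_B1: "g \<in> A \<Longrightarrow> w \<in> B n v \<Longrightarrow> g w \<in> B n (g v)"
proof (induction n arbitrary: w)
  case (Suc n)
  then show ?case using Aut_iff[OF Suc.prems(1)] by simp blast
qed simp

lemma Aut_B: "g \<in> A \<Longrightarrow> g w \<in> B n (g v) \<longleftrightarrow> w \<in> B n v"
  using Aut_B1[of g w n v] Aut_B1[OF inv_Aut(1), of g "g w" n "g v"] by auto

lemma Aut_iv_B: "g \<in> A \<Longrightarrow> iv g w \<in> B n v \<longleftrightarrow> w \<in> B n (g v)"
  using Aut_B[of g "iv g w" n v] by simp

section \<open>Agreement on balls around the base point\<close>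

definition agree :: "nat \<Rightarrow> ('v \<Rightarrow> 'v) \<Rightarrow> ('v \<Rightarrow> 'v) \<Rightarrow> bool" where
  "agree k f g \<longleftrightarrow> (\<forall>x\<in>B k p. f x = g x)"

text \<open>A compact exhaustion of the automorphism group, used as test sets for the Chabauty
  topology.\<close>

definition L :: "nat \<Rightarrow> ('v \<Rightarrow> 'v) set" where
  "L k = {g \<in> A. g p \<in> B k p}"

definition U :: "nat \<Rightarrow> ('v \<Rightarrow> 'v) set" where
  "U k = {g \<in> A. agree k g id}"

lemma agree_refl [simp]: "agree k f f"
  and agree_sym: "agree k f g \<Longrightarrow> agree k g f"
  and agree_trans: "agree k f g \<Longrightarrow> agree k g h \<Longrightarrow> agree k f h"
  by (simp_all add: agree_def)

lemma agree_mono: "m \<le> k \<Longrightarrow> agree k f g \<Longrightarrow> agree m f g"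
  using B_mono by (auto simp: agree_def)

lemma agree_base: "agree k f g \<Longrightarrow> f p = g p"
  by (simp add: agree_def)

text \<open>\<open>g'\<close> carries \<open>B r p\<close> into \<open>B (r + m) p\<close>, so the
  outer factors must agree on the larger ball. This loss is what all later constants count.\<close>

lemma agree_comp:
  assumes "agree (r + m) f f'" "agree r g g'" "g' \<in> L m"
  shows "agree r (f \<circ> g) (f' \<circ> g')"
  unfolding agree_def
proof
  fix x assume x: "x \<in> B r p"
  have "g' x \<in> B r (g' p)" using assms(3) x by (simp add: L_def Aut_B)
  then have "g' x \<in> B (m + r) p" using assms(3) by (auto simp: L_def intro: B_trans)
  then show "(f \<circ> g) x = (f' \<circ> g') x" using assms(1,2) x by (simp add: agree_def add.commute)
qed

lemma L_comp: "f \<in> L m \<Longrightarrow> g \<in> L n \<Longrightarrow> f \<circ> g \<in> L (m + n)"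
  using Aut_B[of f "g p" n p] B_trans[of "f (g p)" n "f p" m p] by (auto simp: L_def comp_Aut)

lemma L_iv: "f \<in> L m \<Longrightarrow> iv f \<in> L m"
  by (auto simp: L_def inv_Aut(1) Aut_iv_B intro: B_sym)

lemma L_mono: "m \<le> n \<Longrightarrow> f \<in> L m \<Longrightarrow> f \<in> L n"
  by (auto simp: L_def intro: B_mono)

lemma L_agree: "agree k f g \<Longrightarrow> f \<in> L m \<Longrightarrow> g \<in> A \<Longrightarrow> g \<in> L m"
  using agree_base[of k f g] by (simp add: L_def)

lemma L_id [simp]: "id \<in> L m"
  using group.is_monoid[OF group_Aut, of E, THEN monoid.one_closed] by (simp add: L_def)

lemma L_exhaust: "f \<in> A \<Longrightarrow> \<exists>m. f \<in> L m"
  using B_exhaust by (simp add: L_def)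

lemma agree_iv_comp:
  assumes "f \<in> A"
  shows "agree k (iv f \<circ> g) id \<longleftrightarrow> agree k f g"
proof -
  have "iv f (g x) = x \<longleftrightarrow> f x = g x" for x using assms by (metis iv_apply(1,2))
  then show ?thesis by (simp add: agree_def)
qed

section \<open>Topology of the automorphism group\<close>

text \<open>A basic open set restricts finitely many coordinates, which lie in a ball by
  connectedness; conversely, balls are finite by local finiteness.\<close>

lemma openin_product_iff:
  "openin (product_topology (\<lambda>_. discrete_topology UNIV) UNIV) S
    \<longleftrightarrow> (\<forall>f\<in>S. \<exists>k. \<forall>g. agree k f g \<longrightarrow> g \<in> S)" (is "openin ?P S \<longleftrightarrow> ?rhs")
proof
  assume S: "openin ?P S"
  show ?rhs
  proof
    fix f assume "f \<in> S"
    then obtain V where V: "finite {i. V i \<noteq> UNIV}" "f \<in> Pi\<^sub>E UNIV V" "Pi\<^sub>E UNIV V \<subseteq> S"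
      using S unfolding openin_product_topology_alt by auto
    obtain k where k: "{i. V i \<noteq> UNIV} \<subseteq> B k p" using finite_subset_B[OF V(1)] by blast
    have "g \<in> S" if "agree k f g" for g
    proof -
      have "g i \<in> V i" for i
      proof (cases "V i = UNIV")
        case False
        then have "f i = g i" using that k by (auto simp: agree_def)
        moreover have "f i \<in> V i" using V(2) by (auto simp: PiE_iff)
        ultimately show ?thesis by simp
      qed simp
      then show ?thesis using V(3) by (auto simp: PiE_iff)
    qed
    then show "\<exists>k. \<forall>g. agree k f g \<longrightarrow> g \<in> S" by blast
  qed
next
  assume r: ?rhs
  show "openin ?P S"
    unfolding openin_product_topology_alt
  proof
    fix f assume "f \<in> S"
    with r obtain k where k: "\<And>g. agree k f g \<Longrightarrow> g \<in> S" by blast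
    have "g \<in> S" if "g \<in> Pi\<^sub>E UNIV (\<lambda>i. if i \<in> B k p then {f i} else UNIV)" for g
    proof (rule k)
      have "g i \<in> (if i \<in> B k p then {f i} else UNIV)" for i using that by (auto simp: PiE_iff)
      then show "agree k f g" unfolding agree_def by (metis singletonD)
    qed
    then show "\<exists>U. finite {i \<in> UNIV. U i \<noteq> topspace (discrete_topology UNIV)} \<and>
        (\<forall>i\<in>UNIV. openin (discrete_topology UNIV) (U i)) \<and> f \<in> Pi\<^sub>E UNIV U \<and> Pi\<^sub>E UNIV U \<subseteq> S"
      using finite_B[of k p]
      by (intro exI[of _ "\<lambda>i. if i \<in> B k p then {f i} else UNIV"])
        (auto simp: PiE_iff elim: rev_finite_subset)
  qed
qed

lemma closedin_product_iff:
  "closedin (product_topology (\<lambda>_. discrete_topology UNIV) UNIV) S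
    \<longleftrightarrow> (\<forall>g. (\<forall>k. \<exists>f\<in>S. agree k g f) \<longrightarrow> g \<in> S)"
  unfolding closedin_def openin_product_iff by simp blast

lemma openin_Aut_iff:
  "openin (Aut_top E) S \<longleftrightarrow> S \<subseteq> A \<and> (\<forall>f\<in>S. \<exists>k. \<forall>g\<in>A. agree k f g \<longrightarrow> g \<in> S)"
proof
  assume "openin (Aut_top E) S"
  then show "S \<subseteq> A \<and> (\<forall>f\<in>S. \<exists>k. \<forall>g\<in>A. agree k f g \<longrightarrow> g \<in> S)"
    unfolding Aut_top_def openin_subtopology openin_product_iff by blast
next
  assume r: "S \<subseteq> A \<and> (\<forall>f\<in>S. \<exists>k. \<forall>g\<in>A. agree k f g \<longrightarrow> g \<in> S)"
  define S' where "S' = {h. \<exists>k. \<forall>g\<in>A. agree k h g \<longrightarrow> g \<in> S}"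
  have "openin (product_topology (\<lambda>_. discrete_topology UNIV) UNIV) S'"
    unfolding openin_product_iff S'_def using agree_trans by blast
  moreover have "S = S' \<inter> A" unfolding S'_def using r by auto
  ultimately show "openin (Aut_top E) S"
    unfolding Aut_top_def openin_subtopology by blast
qed

lemma openin_subtopology_Aut_iff:
  assumes "H \<subseteq> A"
  shows "openin (subtopology (Aut_top E) H) S
    \<longleftrightarrow> S \<subseteq> H \<and> (\<forall>f\<in>S. \<exists>k. \<forall>g\<in>H. agree k f g \<longrightarrow> g \<in> S)"
proof
  assume "openin (subtopology (Aut_top E) H) S"
  then show "S \<subseteq> H \<and> (\<forall>f\<in>S. \<exists>k. \<forall>g\<in>H. agree k f g \<longrightarrow> g \<in> S)"
    unfolding openin_subtopology openin_Aut_iff using assms by blast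
next
  assume r: "S \<subseteq> H \<and> (\<forall>f\<in>S. \<exists>k. \<forall>g\<in>H. agree k f g \<longrightarrow> g \<in> S)"
  define S' where "S' = {h\<in>A. \<exists>k. \<forall>g\<in>H. agree k h g \<longrightarrow> g \<in> S}"
  have "openin (Aut_top E) S'"
    unfolding openin_Aut_iff S'_def using agree_trans by blast
  moreover have "S = S' \<inter> H" unfolding S'_def using r assms by auto
  ultimately show "openin (subtopology (Aut_top E) H) S"
    unfolding openin_subtopology by blast
qed

lemma closedin_AutD:
  assumes "closedin (Aut_top E) H" "g \<in> A" "\<And>k. \<exists>h\<in>H. agree k g h"
  shows "g \<in> H"
proof (rule ccontr)
  assume "g \<notin> H"
  moreover have "openin (Aut_top E) (A - H)" using assms(1) by (simp add: closedin_def topspace_Aut_top)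
  ultimately obtain k where "\<forall>h\<in>A. agree k g h \<longrightarrow> h \<in> A - H"
    using assms(2) unfolding openin_Aut_iff by blast
  moreover have "H \<subseteq> A" using closedin_subset[OF assms(1)] by (simp add: topspace_Aut_top)
  ultimately show False using assms(3)[of k] by blast
qed

text \<open>Adjacency and injectivity involve two vertices and pass to pointwise limits;
  surjectivity in general does not. The displacement bound saves it: preimages of \<open>w\<close>
  under all approximants stay in one ball, on which a good approximant equals
  \<open>g\<close>.\<close>

lemma L_limit:
  assumes "\<And>n. \<exists>f\<in>L k. agree n g f"
  shows "g \<in> L k"
proof -
  have *: "\<exists>f\<in>L k. \<forall>x\<in>F. g x = f x" if "finite F" for F
    using finite_subset_B[OF that, of p] assms unfolding agree_def by blast
  have E: "E (g v) (g w) \<longleftrightarrow> E v w" and inj: "g v = g w \<Longrightarrow> v = w" for v w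
  proof -
    obtain f where f: "f \<in> L k" "g v = f v" "g w = f w" using *[of "{v, w}"] by auto
    then have "f \<in> A" by (simp add: L_def)
    then show "E (g v) (g w) \<longleftrightarrow> E v w" "g v = g w \<Longrightarrow> v = w"
      using f Aut_iff iv_apply(2) by metis+
  qed
  have surj: "\<exists>x. g x = w" for w
  proof -
    obtain m where m: "w \<in> B m p" using B_exhaust by blast
    obtain f where f: "f \<in> L k" "agree (k + m) g f" using assms by blast
    then have "p \<in> B k (f p)" "f \<in> A" by (auto simp: L_def intro: B_sym)
    then have "iv f w \<in> B (k + m) p" using B_trans[OF m] by (simp add: Aut_iv_B)
    then have "g (iv f w) = w" using f(2) \<open>f \<in> A\<close> by (simp add: agree_def)
    then show ?thesis by blast
  qed
  have "g \<in> A" using E inj surj unfolding Aut_def bij_def inj_def surj_def by (auto; metis)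
  moreover obtain f where "f \<in> L k" "g p = f p" using *[of "{p}"] by auto
  ultimately show ?thesis by (simp add: L_def)
qed

lemma compactin_L: "compactin (Aut_top E) (L k)"
proof -
  let ?P = "product_topology (\<lambda>_. discrete_topology UNIV) UNIV"
  have "\<exists>n. v \<in> B n p" for v using B_exhaust by blast
  then obtain n where n: "\<And>v. v \<in> B (n v) p" by metis
  \<comment> \<open>A vertex \<open>v\<close> in \<open>B (n v) p\<close> is moved into the finite
    set \<open>B (k + n v) p\<close>, so \<open>L k\<close> is a closed part of a compact
    product.\<close>
  define K where "K = Pi\<^sub>E UNIV (\<lambda>v. B (k + n v) p)"
  have "compactin ?P K" unfolding K_def by (simp add: compactin_PiE compactin_discrete_topology finite_B)
  moreover have "L k \<subseteq> K"
  proof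
    fix g assume g: "g \<in> L k"
    have "g v \<in> B (k + n v) p" for v
      using g n[of v] by (intro B_trans[of _ _ "g p"]) (auto simp: L_def Aut_B)
    then show "g \<in> K" by (simp add: K_def PiE_iff)
  qed
  moreover have "closedin ?P (L k)" using L_limit by (auto simp: closedin_product_iff)
  ultimately have "compactin ?P (L k)" by (rule closed_compactin)
  then show ?thesis unfolding Aut_top_def compactin_subtopology by (auto simp: L_def)
qed

lemma exists_cluster_point:
  assumes "\<And>n::nat. n \<ge> 1 \<Longrightarrow> \<sigma> n \<in> L m"
  shows "\<exists>\<tau>\<in>L m. \<forall>k. \<exists>\<^sub>F n in sequentially. agree k \<tau> (\<sigma> n)"
proof (rule ccontr)
  assume neg: "\<not> ?thesis"
  \<comment> \<open>Without a cluster point, the open sets that the sequence eventually avoids cover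
    \<open>L m\<close>; a finite subcover would eventually be avoided as a whole.\<close>
  define \<V> where "\<V> = {V. openin (Aut_top E) V \<and> (\<forall>\<^sub>F n in sequentially. \<sigma> n \<notin> V)}"
  have "L m \<subseteq> \<Union>\<V>"
  proof
    fix \<tau> assume "\<tau> \<in> L m"
    with neg obtain k where k: "\<forall>\<^sub>F n in sequentially. \<not> agree k \<tau> (\<sigma> n)"
      by (auto simp: not_frequently)
    have "openin (Aut_top E) {g\<in>A. agree k \<tau> g}"
      unfolding openin_Aut_iff using agree_trans by blast
    then have "{g\<in>A. agree k \<tau> g} \<in> \<V>"
      unfolding \<V>_def using k by (auto elim: eventually_mono)
    moreover have "\<tau> \<in> {g\<in>A. agree k \<tau> g}" using \<open>\<tau> \<in> L m\<close> by (simp add: L_def)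
    ultimately show "\<tau> \<in> \<Union>\<V>" by blast
  qed
  then obtain \<F> where F: "finite \<F>" "\<F> \<subseteq> \<V>" "L m \<subseteq> \<Union>\<F>"
    using compactinD[OF compactin_L, of \<V> m] unfolding \<V>_def by blast
  have "\<forall>\<^sub>F n in sequentially. \<forall>V\<in>\<F>. \<sigma> n \<notin> V"
    using F(1,2) by (intro eventually_ball_finite) (auto simp: \<V>_def)
  moreover have "\<forall>\<^sub>F n in sequentially. \<sigma> n \<in> L m"
    using eventually_ge_at_top[of 1] by eventually_elim (rule assms)
  ultimately have "\<forall>\<^sub>F n::nat in sequentially. False"
    by eventually_elim (use F(3) in auto)
  then show False by simp
qed

section \<open>Neighbourhoods in the Chabauty space\<close>

abbreviation "S \<equiv> Sub (Aut E) (Aut_top E)"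

text \<open>The basic Chabauty neighbourhood for the compact set \<open>L k\<close> and the identity
  neighbourhood \<open>U k\<close>: one radius controls both.\<close>

definition W :: "('v \<Rightarrow> 'v) set \<Rightarrow> nat \<Rightarrow> ('v \<Rightarrow> 'v) set set" where
  "W H k = {J \<in> S. (\<forall>j\<in>J \<inter> L k. \<exists>h\<in>H. agree k h j) \<and> (\<forall>h\<in>H \<inter> L k. \<exists>j\<in>J. agree k j h)}"

lemma SubD:
  assumes "H \<in> S"
  shows "subgroup H (Aut E)" "closedin (Aut_top E) H"
  using assms by (auto simp: Sub_def)

lemma mem_set_mult_U:
  assumes "H \<subseteq> A" "j \<in> A"
  shows "j \<in> H <#>\<^bsub>Aut E\<^esub> U k \<longleftrightarrow> (\<exists>h\<in>H. agree k h j)"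
proof
  assume "j \<in> H <#>\<^bsub>Aut E\<^esub> U k"
  then obtain h u where "h \<in> H" "u \<in> U k" "j = h \<circ> u" by (auto simp: set_mult_def)
  then show "\<exists>h\<in>H. agree k h j" by (auto simp: U_def agree_def)
next
  assume "\<exists>h\<in>H. agree k h j"
  then obtain h where h: "h \<in> H" "h \<in> A" "agree k h j" using assms(1) by blast
  then have "iv h \<circ> j \<in> U k"
    using assms(2) unfolding U_def by (auto simp: comp_Aut inv_Aut(1) agree_iv_comp)
  moreover have "j = h \<circ> (iv h \<circ> j)" using h(2) by (simp add: fun_eq_iff)
  ultimately show "j \<in> H <#>\<^bsub>Aut E\<^esub> U k" using h(1) by (auto simp: set_mult_def)
qed

lemma chabauty_nbhd_eq_W:
  assumes "H \<in> S"
  shows "chabauty_nbhd (Aut E) (Aut_top E) H (L k) (U k) = W H k"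
proof -
  have sub: "J \<subseteq> A" if "J \<in> S" for J using SubD(1)[OF that] by (rule subgroup.subset)
  have "J \<inter> L k \<subseteq> H <#>\<^bsub>Aut E\<^esub> U k \<longleftrightarrow> (\<forall>j\<in>J \<inter> L k. \<exists>h\<in>H. agree k h j)"
      "H \<inter> L k \<subseteq> J <#>\<^bsub>Aut E\<^esub> U k \<longleftrightarrow> (\<forall>h\<in>H \<inter> L k. \<exists>j\<in>J. agree k j h)" if "J \<in> S" for J
    using mem_set_mult_U[OF sub[OF that]] mem_set_mult_U[OF sub[OF assms]]
    by (auto simp: L_def)
  then show ?thesis unfolding chabauty_nbhd_def W_def by blast
qed

lemma openin_U: "openin (Aut_top E) (U k)"
  unfolding openin_Aut_iff U_def using agree_trans agree_sym by blast

lemma chabauty_openI: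
  assumes "\<U> \<subseteq> S" "\<And>H. H \<in> \<U> \<Longrightarrow> \<exists>k. W H k \<subseteq> \<U>"
  shows "openin (chabauty (Aut E) (Aut_top E)) \<U>"
  unfolding openin_chabauty chabauty_open_def
proof (intro conjI ballI assms(1))
  fix H assume H: "H \<in> \<U>"
  then obtain k where "W H k \<subseteq> \<U>" using assms(2) by blast
  moreover have "\<one>\<^bsub>Aut E\<^esub> \<in> U k" using L_id by (simp add: U_def L_def)
  ultimately show "\<exists>K U. compactin (Aut_top E) K \<and> openin (Aut_top E) U \<and> \<one>\<^bsub>Aut E\<^esub> \<in> U \<and>
      chabauty_nbhd (Aut E) (Aut_top E) H K U \<subseteq> \<U>"
    using compactin_L openin_U chabauty_nbhd_eq_W[of H k] H assms(1)
    by (intro exI[of _ "L k"] exI[of _ "U k"]) auto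
qed

text \<open>Agreement on a fixed ball is an equivalence relation that preserves \<open>L k\<close>, so the sets
  \<open>W H k\<close> for fixed \<open>k\<close> partition the Chabauty space; this makes them open.\<close>

lemma openin_W:
  assumes "H \<in> S"
  shows "openin (chabauty (Aut E) (Aut_top E)) (W H k)"
proof (rule chabauty_openI)
  show "W H k \<subseteq> S" by (auto simp: W_def)
  have sub: "J \<subseteq> A" if "J \<in> S" for J using SubD(1)[OF that] by (rule subgroup.subset)
  have trans: "\<forall>j\<in>J2 \<inter> L k. \<exists>h\<in>J0. agree k h j"
    if J: "J1 \<in> S" and J0: "\<forall>j\<in>J1 \<inter> L k. \<exists>h\<in>J0. agree k h j"
      and J2: "\<forall>j\<in>J2 \<inter> L k. \<exists>h\<in>J1. agree k h j"
    for J0 J1 J2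
  proof
    fix j assume "j \<in> J2 \<inter> L k"
    then obtain h where h: "h \<in> J1" "agree k h j" "j \<in> L k" using J2 by blast
    then have "h \<in> L k" using L_agree[OF agree_sym] sub[OF J] by blast
    then show "\<exists>h\<in>J0. agree k h j" using J0 h agree_trans by blast
  qed
  fix J assume J: "J \<in> W H k"
  have "W J k \<subseteq> W H k"
  proof
    fix J' assume J': "J' \<in> W J k"
    show "J' \<in> W H k"
      using J J' trans[of J H J'] trans[of J J' H] unfolding W_def by blast
  qed
  then show "\<exists>k'. W J k' \<subseteq> W H k" by blast
qed

lemma limitin_chabautyD:
  assumes "limitin (chabauty (Aut E) (Aut_top E)) Hs H F"
  shows "H \<in> S" "\<forall>\<^sub>F n in F. Hs n \<in> W H k"
proof -
  show H: "H \<in> S" using limitin_topspace[OF assms] by (simp add: topspace_chabauty)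
  then have "H \<in> W H k" using agree_refl unfolding W_def by blast
  then show "\<forall>\<^sub>F n in F. Hs n \<in> W H k"
    using assms openin_W[OF H] unfolding limitin_def by blast
qed

section \<open>Transferring homomorphisms between nearby subgroups\<close>

text \<open>Quantitative cocompactness: all orbits are \<open>R\<close>-dense. It passes to
  conjugates with the same \<open>R\<close>.\<close>

definition cobounded :: "nat \<Rightarrow> ('v \<Rightarrow> 'v) set \<Rightarrow> bool" where
  "cobounded R \<Gamma> \<longleftrightarrow> (\<forall>v w. \<exists>g\<in>\<Gamma>. g w \<in> B R v)"

text \<open>Follow a path from \<open>p\<close> to \<open>g p\<close> and choose a translate of
  \<open>p\<close> within \<open>R\<close> of each vertex; consecutive choices differ by an element
  of displacement at most \<open>R + 1 + R\<close>.\<close>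

lemma cobounded_induct [consumes 3, case_names generator comp]:
  assumes \<Gamma>: "subgroup \<Gamma> (Aut E)" "cobounded R \<Gamma>" and g: "g \<in> \<Gamma>"
    and gen: "\<And>g. g \<in> \<Gamma> \<Longrightarrow> g \<in> L (2 * R + 1) \<Longrightarrow> P g"
    and comp: "\<And>f g. f \<in> \<Gamma> \<Longrightarrow> g \<in> \<Gamma> \<Longrightarrow> P f \<Longrightarrow> P g \<Longrightarrow> P (f \<circ> g)"
  shows "P g"
proof -
  \<comment> \<open>The induction is on the radius of a vertex \<open>v\<close> merely near
    \<open>g p\<close>, so that any \<open>f\<close> with \<open>f p\<close> near the predecessor of
    \<open>v\<close> falls under the induction hypothesis.\<close>
  have "P g" if "g \<in> \<Gamma>" "v \<in> B n p" "g p \<in> B R v" for n v g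
    using that
  proof (induction n arbitrary: v g)
    case 0
    have "g \<in> L R" using 0 \<Gamma> by (auto simp: L_def subgroup_AutD)
    then show ?case using gen[OF 0(1)] L_mono[of R "2 * R + 1" g] by simp
  next
    case (Suc n)
    show ?case
    proof (cases "v \<in> B n p")
      case False
      then obtain x where x: "x \<in> B n p" "E x v" using Suc.prems by auto
      obtain f where f: "f \<in> \<Gamma>" "f p \<in> B R x" using \<Gamma>(2) unfolding cobounded_def by blast
      have A: "f \<in> A" "g \<in> A" using f Suc.prems \<Gamma>(1) by (auto simp: subgroup_AutD)
      have "v \<in> B 1 x" using x by auto
      then have "v \<in> B (R + 1) (f p)" using B_sym[OF f(2)] by (rule B_trans)
      then have "g p \<in> B (R + 1 + R) (f p)" using Suc.prems(3) by (rule B_trans[rotated])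
      then have "iv f \<circ> g \<in> L (2 * R + 1)"
        using Aut_iv_B[OF A(1), of "g p" "R + 1 + R" p] A
        by (simp add: L_def comp_Aut inv_Aut(1) mult_2 del: gball.simps)
      moreover have "iv f \<circ> g \<in> \<Gamma>" using f Suc.prems \<Gamma>(1) by (auto intro: subgroup_AutD)
      ultimately have "P (f \<circ> (iv f \<circ> g))"
        using comp[OF f(1)] Suc.IH[OF f(1) x(1) f(2)] gen by blast
      moreover have "f \<circ> (iv f \<circ> g) = g" using A(1) by (simp add: fun_eq_iff)
      ultimately show ?thesis by simp
    qed (use Suc in blast)
  qed
  from this[OF g, of "g p"] show ?thesis using B_exhaust by auto
qed

end

locale hom_transfer = lf_graph +
  fixes H J \<Gamma> :: "('a \<Rightarrow> 'a) set" and R r k :: nat and u :: "'a \<Rightarrow> 'a"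
    and \<phi> :: "('a \<Rightarrow> 'a) \<Rightarrow> 'c \<Rightarrow> 'c"
  assumes H: "subgroup H (Aut E)" and J: "subgroup J (Aut E)" and \<Gamma>: "subgroup \<Gamma> (Aut E)"
    and \<Gamma>_H: "\<Gamma> \<subseteq> H" and cob: "cobounded R \<Gamma>"
    and \<phi>_comp: "\<And>f g. f \<in> H \<Longrightarrow> g \<in> H \<Longrightarrow> \<phi> (f \<circ> g) = \<phi> f \<circ> \<phi> g"
    and \<phi>_small: "\<And>h. h \<in> H \<Longrightarrow> agree r h id \<Longrightarrow> \<phi> h = id"
    and k: "r + 8 * R + 2 \<le> k" \<comment> \<open>the largest displacement met below is \<open>4 * R + 1\<close>; it enters as \<open>r + 2 * (4 * R + 1)\<close> through \<open>\<psi>_comp\<close>\<close>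
    and J_H: "\<And>j. j \<in> J \<Longrightarrow> j \<in> L k \<Longrightarrow> \<exists>h\<in>H. agree k h j"
    and H_J: "\<And>h. h \<in> H \<Longrightarrow> h \<in> L k \<Longrightarrow> \<exists>j\<in>J. agree k j h"
    and u: "u \<in> U k" and u_\<Gamma>: "\<And>g. g \<in> \<Gamma> \<Longrightarrow> u \<circ> g \<circ> iv u \<in> J"
begin

section \<open>The local homomorphism on elements of bounded displacement\<close>

lemmas H_simps = subgroup_AutD[OF H] and J_simps = subgroup_AutD[OF J]
  and \<Gamma>_simps = subgroup_AutD[OF \<Gamma>]

text \<open>Embeds \<open>\<Gamma>\<close> in \<open>J\<close>. As \<open>u\<close> fixes
  \<open>B k p\<close>, \<open>c g\<close> and \<open>g\<close> agree near \<open>p\<close> when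
  \<open>g\<close> has small displacement.\<close>

definition c :: "('a \<Rightarrow> 'a) \<Rightarrow> 'a \<Rightarrow> 'a" where "c g = u \<circ> g \<circ> iv u"

text \<open>An approximant \<open>h\<close> exists for \<open>j\<close> in
  \<open>J \<inter> L k\<close>, and its choice does not matter since \<open>\<phi> h\<close>
  depends only on \<open>h\<close> on \<open>B r p\<close>.\<close>

definition \<psi> :: "('a \<Rightarrow> 'a) \<Rightarrow> 'c \<Rightarrow> 'c" where
  "\<psi> j = \<phi> (SOME h. h \<in> H \<and> agree r h j)"

definition \<Phi> :: "('a \<Rightarrow> 'a) \<Rightarrow> 'c \<Rightarrow> 'c" where
  "\<Phi> j = (SOME q. \<exists>g\<in>\<Gamma>. \<exists>s\<in>J \<inter> L R. j = c g \<circ> s \<and> q = \<phi> g \<circ> \<psi> s)"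

lemma u_A: "u \<in> A" and u_fix: "x \<in> B k p \<Longrightarrow> u x = x"
  using u by (auto simp: U_def agree_def)

lemma iv_u_fix: "x \<in> B k p \<Longrightarrow> iv u x = x"
  using u_fix[of x] iv_apply(2)[OF u_A, of x] by simp

lemma c_comp: "c (f \<circ> g) = c f \<circ> c g"
  using u_A by (simp add: c_def fun_eq_iff)

lemma c_id: "c id = id"
  using u_A by (simp add: c_def)

lemma c_J: "g \<in> \<Gamma> \<Longrightarrow> c g \<in> J"
  by (simp add: c_def u_\<Gamma>)

lemma c_L: "g \<in> \<Gamma> \<Longrightarrow> c g \<in> L m \<longleftrightarrow> g \<in> L m"
  using Aut_B[OF u_A, of "g p" m p] u_fix[of p] iv_u_fix[of p] \<Gamma>_simps(4)[of g] J_simps(4)[OF c_J, of g]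
  by (simp add: L_def) (simp add: c_def)

lemma \<phi>_id: "\<phi> id = id"
  using \<phi>_small[of id] H_simps(1) by simp

lemma \<phi>_agree:
  assumes "h \<in> H" "h' \<in> H" "agree r h h'"
  shows "\<phi> h = \<phi> h'"
proof -
  have "iv h \<circ> h' \<in> H" using assms by (intro H_simps)
  moreover have "agree r (iv h \<circ> h') id" using assms H_simps(4) by (simp add: agree_iv_comp)
  moreover have "h' = h \<circ> (iv h \<circ> h')" using H_simps(4)[OF assms(1)] by (simp add: fun_eq_iff)
  ultimately show ?thesis using \<phi>_comp[OF assms(1)] \<phi>_small by (metis comp_id)
qed

lemma \<psi>_eq: "h \<in> H \<Longrightarrow> agree r h j \<Longrightarrow> \<psi> j = \<phi> h"
  unfolding \<psi>_def by (rule someI2[of _ h]) (auto intro: \<phi>_agree agree_trans agree_sym)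

text \<open>Approximants of \<open>f\<close> and \<open>g\<close> with radius \<open>k\<close>
  compose to an approximant of \<open>f \<circ> g\<close> that is still good on
  \<open>B r p\<close>.\<close>

lemma \<psi>_comp:
  assumes "f \<in> J" "g \<in> J" "f \<in> L m" "g \<in> L m" "r + 2 * m \<le> k"
  shows "\<psi> (f \<circ> g) = \<psi> f \<circ> \<psi> g"
proof -
  have "f \<in> L k" "g \<in> L k" using L_mono[of m k] assms by auto
  then obtain f' g' where *: "f' \<in> H" "agree k f' f" "g' \<in> H" "agree k g' g"
    using J_H assms by meson
  have "agree r (f' \<circ> g') (f \<circ> g)"
    using agree_mono[OF _ *(2), of "r + m"] agree_mono[OF _ *(4), of r] assms by (intro agree_comp) auto
  then have "\<psi> (f \<circ> g) = \<phi> (f' \<circ> g')" using * by (intro \<psi>_eq H_simps)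
  also have "\<dots> = \<psi> f \<circ> \<psi> g"
    using * \<phi>_comp \<psi>_eq[of f' f] \<psi>_eq[of g' g] agree_mono[of r k] assms(5) by simp
  finally show ?thesis .
qed

text \<open>\<open>g\<close> maps \<open>B r p\<close> into \<open>B (m + r) p\<close>, where
  \<open>u\<close> is the identity; so \<open>g\<close> itself is an approximant of
  \<open>c g\<close> in \<open>H\<close>.\<close>

lemma \<psi>_c:
  assumes "g \<in> \<Gamma>" "g \<in> L m" "r + m \<le> k"
  shows "\<psi> (c g) = \<phi> g"
proof (rule \<psi>_eq)
  show "agree r g (c g)"
    unfolding agree_def
  proof
    fix x assume x: "x \<in> B r p"
    then have "g x \<in> B (m + r) p"
      using assms(2) by (intro B_trans[of _ _ "g p"]) (auto simp: L_def Aut_B)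
    then have "u (g x) = g x" using assms(3) B_mono[of "m + r" k] by (intro u_fix) auto
    moreover have "iv u x = x" using B_mono[OF _ x, of k] assms(3) by (intro iv_u_fix) auto
    ultimately show "g x = c g x" by (simp add: c_def)
  qed
qed (use assms \<Gamma>_H in auto)

section \<open>Extension to a homomorphism on the whole nearby subgroup\<close>

lemma J_decomp:
  assumes "j \<in> J"
  obtains g s where "g \<in> \<Gamma>" "s \<in> J" "s \<in> L R" "j = c g \<circ> s"
proof -
  \<comment> \<open>Moving \<open>iv u (j p)\<close> close to \<open>p\<close> is the right choice
    because \<open>c g (j p) = u (g (iv u (j p)))\<close> and \<open>u\<close> fixes
    \<open>p\<close>.\<close>
  obtain g where g: "g \<in> \<Gamma>" "g (iv u (j p)) \<in> B R p" using cob unfolding cobounded_def by blast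
  have "c g \<circ> j \<in> J" using g c_J assms by (intro J_simps)
  moreover have "c g (j p) \<in> B R p"
    using g(2) Aut_B[OF u_A, of "g (iv u (j p))" R p] u_fix[of p] by (simp add: c_def)
  ultimately have "c g \<circ> j \<in> L R" using J_simps(4) by (simp add: L_def)
  moreover have "j = c (iv g) \<circ> (c g \<circ> j)"
    using \<Gamma>_simps(4)[OF g(1)] c_comp[of "iv g" g] c_id by (simp add: o_assoc)
  ultimately show thesis using that \<Gamma>_simps(3)[OF g(1)] \<open>c g \<circ> j \<in> J\<close> by blast
qed

text \<open>Two decompositions differ by \<open>c (iv g' \<circ> g) = s' \<circ> iv s\<close>. It
  comes from \<open>\<Gamma>\<close>, where \<open>\<phi>\<close> is multiplicative, and has
  displacement at most \<open>2 * R\<close>, where \<open>\<psi>\<close> is.\<close>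

lemma \<Phi>_unique:
  assumes g: "g \<in> \<Gamma>" "s \<in> J" "s \<in> L R" and g': "g' \<in> \<Gamma>" "s' \<in> J" "s' \<in> L R"
    and eq: "c g \<circ> s = c g' \<circ> s'"
  shows "\<phi> g \<circ> \<psi> s = \<phi> g' \<circ> \<psi> s'"
proof -
  let ?d = "iv g' \<circ> g"
  have d: "?d \<in> \<Gamma>" using g g' by (intro \<Gamma>_simps)
  have "c ?d \<circ> s = c (iv g' \<circ> g') \<circ> s'" using eq by (simp add: c_comp comp_assoc)
  then have ds: "c ?d \<circ> s = s'" using \<Gamma>_simps(4)[OF g'(1)] by (simp add: c_id)
  then have "c ?d = s' \<circ> iv s" using J_simps(4)[OF g(2)] by (auto simp: comp_assoc)
  then have "c ?d \<in> L (R + R)" using g g' by (simp add: L_comp L_iv)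
  then have dL: "?d \<in> L (2 * R)" "c ?d \<in> L (2 * R)" using c_L[OF d] by (simp_all add: mult_2)
  have "\<psi> s' = \<psi> (c ?d) \<circ> \<psi> s"
    unfolding ds[symmetric] using c_J[OF d] g dL L_mono[of R "2 * R" s] k by (intro \<psi>_comp[where m = "2 * R"]) auto
  also have "\<psi> (c ?d) = \<phi> ?d" using \<psi>_c[OF d dL(1)] k by simp
  finally have "\<phi> g' \<circ> \<psi> s' = \<phi> g' \<circ> \<phi> ?d \<circ> \<psi> s" by (simp only: comp_assoc)
  also have "\<phi> g' \<circ> \<phi> ?d = \<phi> (g' \<circ> ?d)" using g' d \<Gamma>_H by (intro \<phi>_comp[symmetric]) auto
  also have "g' \<circ> ?d = g" using \<Gamma>_simps(4)[OF g'(1)] by (simp add: o_assoc)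
  finally show ?thesis ..
qed

lemma \<Phi>_eq:
  assumes "g \<in> \<Gamma>" "s \<in> J" "s \<in> L R"
  shows "\<Phi> (c g \<circ> s) = \<phi> g \<circ> \<psi> s"
  unfolding \<Phi>_def
proof (rule some_equality)
  show "\<exists>g'\<in>\<Gamma>. \<exists>s'\<in>J \<inter> L R. c g \<circ> s = c g' \<circ> s' \<and> \<phi> g \<circ> \<psi> s = \<phi> g' \<circ> \<psi> s'"
    using assms by blast
qed (metis IntD1 IntD2 \<Phi>_unique[OF assms])

lemma \<Phi>_c:
  assumes "g \<in> \<Gamma>" "j \<in> J"
  shows "\<Phi> (c g \<circ> j) = \<phi> g \<circ> \<Phi> j"
proof -
  obtain f s where *: "f \<in> \<Gamma>" "s \<in> J" "s \<in> L R" "j = c f \<circ> s" using J_decomp[OF assms(2)] .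
  have "c g \<circ> j = c (g \<circ> f) \<circ> s" using * by (simp add: c_comp comp_assoc)
  then show ?thesis
    using * assms \<Phi>_eq[of "g \<circ> f" s] \<Gamma>_simps(2) \<phi>_comp[of g f] \<Gamma>_H by (simp add: \<Phi>_eq comp_assoc subset_iff)
qed

text \<open>The bound \<open>3 * R + 1\<close> is what a remainder in \<open>L R\<close> times a
  generator in \<open>L (2 * R + 1)\<close> can reach. Dividing off the remainder adds another
  \<open>R\<close>, whence \<open>4 * R + 1\<close>.\<close>

lemma \<Phi>_eq_\<psi>:
  assumes "j \<in> J" "j \<in> L (3 * R + 1)"
  shows "\<Phi> j = \<psi> j"
proof -
  obtain g s where *: "g \<in> \<Gamma>" "s \<in> J" "s \<in> L R" "j = c g \<circ> s" using J_decomp[OF assms(1)] .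
  then have "c g = j \<circ> iv s" using J_simps(4)[OF *(2)] by (simp add: comp_assoc)
  then have "c g \<in> L (3 * R + 1 + R)" using L_comp[OF assms(2) L_iv[OF *(3)]] by simp
  then have L: "c g \<in> L (4 * R + 1)" "g \<in> L (4 * R + 1)" using c_L[OF *(1)] by (simp_all add: algebra_simps)
  have "\<psi> j = \<psi> (c g) \<circ> \<psi> s"
    unfolding *(4) using c_J * L(1) L_mono[of R "4 * R + 1" s] k by (intro \<psi>_comp[where m = "4 * R + 1"]) auto
  also have "\<psi> (c g) = \<phi> g" using *(1) L(2) k by (intro \<psi>_c) auto
  finally show ?thesis using \<Phi>_eq[OF *(1-3)] *(4) by metis
qed

text \<open>Left factors \<open>c g\<close> are absorbed by the decomposition, but a right factor
  meets the remainder \<open>s\<close>. For a generator, \<open>s \<circ> c g\<close> is still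
  within reach of \<open>\<psi>\<close>; a longer \<open>g\<close> is split, with
  \<open>j \<circ> c f\<close> in place of \<open>j\<close>.\<close>

lemma \<Phi>_comp_c:
  assumes "g \<in> \<Gamma>" "j \<in> J"
  shows "\<Phi> (j \<circ> c g) = \<Phi> j \<circ> \<phi> g"
  using \<Gamma> cob assms
proof (induction g arbitrary: j rule: cobounded_induct)
  case (generator g)
  obtain f s where *: "f \<in> \<Gamma>" "s \<in> J" "s \<in> L R" "j = c f \<circ> s" using J_decomp[OF generator(3)] .
  have sL: "s \<in> L (2 * R + 1)" "s \<in> L (3 * R + 1)" using L_mono[OF _ *(3)] by auto
  have cg: "c g \<in> J" "c g \<in> L (2 * R + 1)" using generator c_J c_L by auto
  have "s \<circ> c g \<in> L (R + (2 * R + 1))" using * cg by (intro L_comp)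
  then have scg: "s \<circ> c g \<in> L (3 * R + 1)" "s \<circ> c g \<in> J" using * cg J_simps(2) by (auto simp: algebra_simps)
  have "\<Phi> (s \<circ> c g) = \<psi> s \<circ> \<psi> (c g)"
    using scg * sL cg k by (simp add: \<Phi>_eq_\<psi> \<psi>_comp[where m = "2 * R + 1"])
  also have "\<dots> = \<Phi> s \<circ> \<phi> g" using generator(1,2) k *(2) sL by (simp add: \<Phi>_eq_\<psi> \<psi>_c)
  finally have "\<Phi> (c f \<circ> (s \<circ> c g)) = \<phi> f \<circ> (\<Phi> s \<circ> \<phi> g)" using \<Phi>_c[OF *(1) scg(2)] by simp
  then show ?case using \<Phi>_c[OF *(1,2)] unfolding *(4) by (simp only: comp_assoc)
next
  case (comp f g)
  have "\<Phi> (j \<circ> c (f \<circ> g)) = \<Phi> (j \<circ> c f \<circ> c g)" by (simp add: c_comp comp_assoc)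
  also have "\<dots> = \<Phi> j \<circ> \<phi> f \<circ> \<phi> g"
    by (simp only: comp c_J J_simps(2))
  also have "\<dots> = \<Phi> j \<circ> \<phi> (f \<circ> g)"
    using \<phi>_comp[of f g] comp(1,2) \<Gamma>_H by (metis comp_assoc subsetD)
  finally show ?case .
qed

lemma \<Phi>_comp:
  assumes "i \<in> J" "j \<in> J"
  shows "\<Phi> (i \<circ> j) = \<Phi> i \<circ> \<Phi> j"
proof -
  \<comment> \<open>With \<open>i = c f \<circ> t\<close>, the product \<open>t \<circ> s\<close>
    has displacement at most \<open>2 * R\<close>, so \<open>\<Phi>\<close> is \<open>\<psi>\<close>
    on it.\<close>
  have small: "\<Phi> (i \<circ> s) = \<Phi> i \<circ> \<psi> s" if i: "i \<in> J" and s: "s \<in> J" "s \<in> L R" for i s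
  proof -
    obtain f t where *: "f \<in> \<Gamma>" "t \<in> J" "t \<in> L R" "i = c f \<circ> t" using J_decomp[OF i] .
    have "t \<circ> s \<in> L (R + R)" using * s by (intro L_comp)
    then have ts: "t \<circ> s \<in> L (3 * R + 1)" "t \<circ> s \<in> J" using L_mono[of "R + R" "3 * R + 1"] * s J_simps(2) by auto
    then have "\<Phi> (t \<circ> s) = \<psi> t \<circ> \<psi> s" using * s k by (simp add: \<Phi>_eq_\<psi> \<psi>_comp[where m = R])
    then show ?thesis using \<Phi>_c[OF *(1) ts(2)] \<Phi>_eq[OF *(1-3)] *(4) by (simp add: comp_assoc)
  qed
  obtain g s where *: "g \<in> \<Gamma>" "s \<in> J" "s \<in> L R" "j = c g \<circ> s" using J_decomp[OF assms(2)] .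
  have "\<Phi> (i \<circ> c g \<circ> s) = \<Phi> i \<circ> \<phi> g \<circ> \<psi> s"
    using small[of "i \<circ> c g" s] \<Phi>_comp_c[OF *(1) assms(1)] assms * c_J J_simps(2) by simp
  then show ?thesis using \<Phi>_eq[OF *(1-3)] *(4) by (simp add: comp_assoc)
qed

lemma \<Phi>_small:
  assumes "j \<in> J" "agree k j id"
  shows "\<Phi> j = id"
proof -
  have "j \<in> L (3 * R + 1)" using assms agree_base[OF assms(2)] J_simps(4) by (simp add: L_def)
  then have "\<Phi> j = \<psi> j" using assms by (simp add: \<Phi>_eq_\<psi>)
  also have "\<dots> = \<phi> id" using agree_mono[OF _ agree_sym[OF assms(2)], of r] k H_simps(1) by (intro \<psi>_eq) auto
  finally show ?thesis by (simp add: \<phi>_id)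
qed

lemma \<Phi>_image: "\<Phi> ` J = \<phi> ` H"
proof (intro subset_antisym subsetI)
  fix q assume "q \<in> \<Phi> ` J"
  then obtain j where j: "j \<in> J" "q = \<Phi> j" by auto
  obtain g s where *: "g \<in> \<Gamma>" "s \<in> J" "s \<in> L R" "j = c g \<circ> s" using J_decomp[OF j(1)] .
  obtain h where h: "h \<in> H" "agree k h s" using J_H[OF *(2)] L_mono[OF _ *(3), of k] k by auto
  then have "\<psi> s = \<phi> h" using agree_mono[of r k h s] k by (intro \<psi>_eq) auto
  then have "q = \<phi> (g \<circ> h)" using j * \<Phi>_eq[OF *(1-3)] \<phi>_comp[of g h] h(1) \<Gamma>_H by auto
  then show "q \<in> \<phi> ` H" using *(1) h(1) \<Gamma>_H H_simps(2) by blast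
next
  fix q assume "q \<in> \<phi> ` H"
  then obtain h where h: "h \<in> H" "q = \<phi> h" by auto
  \<comment> \<open>Only elements of bounded displacement can be approximated in \<open>J\<close>,
    so \<open>h\<close> is first moved into \<open>L R\<close> by \<open>\<Gamma>\<close>;
    \<open>c (iv g)\<close> undoes this inside \<open>J\<close>.\<close>
  obtain g where g: "g \<in> \<Gamma>" "g (h p) \<in> B R p" using cob unfolding cobounded_def by blast
  have gh: "g \<circ> h \<in> H" using g \<Gamma>_H h by (auto intro: H_simps)
  then have L: "g \<circ> h \<in> L R" using g H_simps(4) by (simp add: L_def)
  then obtain s where s: "s \<in> J" "agree k s (g \<circ> h)" using H_J[OF gh] L_mono[of R k] k by auto
  have sL: "s \<in> L R" using L_agree[OF agree_sym[OF s(2)] L] J_simps(4) s(1) by simp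
  have "\<psi> s = \<phi> (g \<circ> h)" using agree_mono[OF _ agree_sym[OF s(2)], of r] k gh by (intro \<psi>_eq) auto
  then have "\<Phi> (c (iv g) \<circ> s) = \<phi> (iv g) \<circ> \<phi> (g \<circ> h)" using \<Phi>_eq g \<Gamma>_simps(3) s(1) sL by simp
  also have "\<dots> = \<phi> (iv g \<circ> (g \<circ> h))"
    using \<Gamma>_simps(3)[OF g(1)] \<Gamma>_H gh by (intro \<phi>_comp[symmetric]) auto
  also have "iv g \<circ> (g \<circ> h) = h" using \<Gamma>_simps(4)[OF g(1)] by (simp add: o_assoc)
  finally show "q \<in> \<Phi> ` J"
    using h(2) J_simps(2)[OF c_J[OF \<Gamma>_simps(3)[OF g(1)]] s(1)] by (metis image_eqI)
qed

end

section \<open>Lower semicontinuity of the index\<close>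

context lf_graph
begin

lemma
  assumes "subgroup H (Aut E)"
  shows group_restrict_Aut: "group (Aut E\<lparr>carrier := H\<rparr>)"
    and topspace_subtopology_Aut:
      "topspace (subtopology (Aut_top E) H) = carrier (Aut E\<lparr>carrier := H\<rparr>)"
  using subgroup.subgroup_is_group[OF assms group_Aut] subgroup.subset[OF assms]
  by (auto simp: topspace_Aut_top)

abbreviation res_index :: "('v \<Rightarrow> 'v) set \<Rightarrow> enat" where
  "res_index \<equiv> sub_residual_index (Aut E) (Aut_top E)"

abbreviation ofi :: "('v \<Rightarrow> 'v) set \<Rightarrow> ('v \<Rightarrow> 'v) set \<Rightarrow> bool" where
  "ofi H \<equiv> open_finite_index (Aut E\<lparr>carrier := H\<rparr>) (subtopology (Aut_top E) H)"

abbreviation cosets :: "('v \<Rightarrow> 'v) set \<Rightarrow> ('v \<Rightarrow> 'v) set \<Rightarrow> ('v \<Rightarrow> 'v) set set" where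
  "cosets H N \<equiv> rcosets\<^bsub>Aut E\<lparr>carrier := H\<rparr>\<^esub> N"

lemma cosets_eq: "cosets H N = (\<lambda>a. (\<lambda>n. n \<circ> a) ` N) ` H"
  by (auto simp: RCOSETS_def r_coset_def)

text \<open>The kernel is open because \<open>\<Phi>\<close> is trivial near the identity, and its
  cosets are the fibres, so it has finite index. Hence it contains the residual, and
  \<open>\<Phi>\<close> is constant on the cosets of the residual.\<close>

lemma card_image_le_res_index:
  assumes J: "subgroup J (Aut E)"
    and comp: "\<And>i j. i \<in> J \<Longrightarrow> j \<in> J \<Longrightarrow> \<Phi> (i \<circ> j) = \<Phi> i \<circ> \<Phi> j"
    and small: "\<And>j. j \<in> J \<Longrightarrow> agree k j id \<Longrightarrow> \<Phi> j = id"
    and fin: "finite (\<Phi> ` J)"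
  shows "enat (card (\<Phi> ` J)) \<le> res_index J"
proof -
  note Js = subgroup_AutD[OF J]
  let ?G = "Aut E\<lparr>carrier := J\<rparr>"
  define K where "K = {j\<in>J. \<Phi> j = id}"
  have id: "\<Phi> id = id" using small[OF Js(1)] by simp
  have inv: "\<Phi> i \<circ> \<Phi> (iv i) = id" "\<Phi> (iv i) \<circ> \<Phi> i = id" if "i \<in> J" for i
    using comp[OF that Js(3)[OF that]] comp[OF Js(3)[OF that] that] Js(4)[OF that] id by simp_all
  have KA: "subgroup K (Aut E)"
  proof (rule subgroup.intro)
    show "K \<subseteq> carrier (Aut E)" using Js(4) by (auto simp: K_def)
    show "x \<otimes>\<^bsub>Aut E\<^esub> y \<in> K" if "x \<in> K" "y \<in> K" for x y
      using that Js(2) comp by (simp add: K_def)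
    show "\<one>\<^bsub>Aut E\<^esub> \<in> K" using Js(1) id by (simp add: K_def)
    show "inv\<^bsub>Aut E\<^esub> x \<in> K" if "x \<in> K" for x
      using that Js(3,4)[of x] inv(1)[of x] by (simp add: K_def inv_Aut(2))
  qed
  have "subgroup K ?G"
    by (rule group.subgroup_incl[OF group_Aut KA J]) (auto simp: K_def)
  moreover have "openin (subtopology (Aut_top E) J) K"
    unfolding openin_subtopology_Aut_iff[OF subgroup.subset[OF J]]
  proof (intro conjI ballI)
    show "K \<subseteq> J" by (auto simp: K_def)
    fix f assume f: "f \<in> K"
    have "g \<in> K" if g: "g \<in> J" "agree k f g" for g
    proof -
      have fJ: "f \<in> J" "f \<in> A" "\<Phi> f = id" using f Js(4) by (auto simp: K_def)
      have "\<Phi> (iv f \<circ> g) = id"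
        using fJ g Js(2,3) by (intro small) (auto simp: agree_iv_comp)
      then have "\<Phi> (iv f) \<circ> \<Phi> g = id" using comp Js(3)[OF fJ(1)] g(1) by simp
      then show ?thesis using inv(1)[OF fJ(1)] fJ(3) g(1) by (simp add: K_def)
    qed
    then show "\<exists>k. \<forall>g\<in>J. agree k f g \<longrightarrow> g \<in> K" by blast
  qed
  moreover have "cosets J K \<subseteq> (\<lambda>q. {j\<in>J. \<Phi> j = q}) ` (\<Phi> ` J)"
  proof
    fix C assume "C \<in> cosets J K"
    then obtain a where a: "a \<in> J" "C = (\<lambda>n. n \<circ> a) ` K" by (auto simp: cosets_eq)
    have "j \<in> C" if j: "j \<in> J" "\<Phi> j = \<Phi> a" for j
    proof -
      have "\<Phi> (j \<circ> iv a) = id" using comp[OF j(1) Js(3)[OF a(1)]] j(2) inv(1)[OF a(1)] by simp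
      then have "j \<circ> iv a \<in> K" using Js(2)[OF j(1) Js(3)[OF a(1)]] by (simp add: K_def)
      moreover have "j = (j \<circ> iv a) \<circ> a" using Js(4)[OF a(1)] by (simp add: comp_assoc)
      ultimately show ?thesis unfolding a(2) by (metis image_eqI)
    qed
    moreover have "j \<in> J \<and> \<Phi> j = \<Phi> a" if "j \<in> C" for j
      using that a Js(2) comp by (auto simp: K_def)
    ultimately have "C = {j\<in>J. \<Phi> j = \<Phi> a}" by blast
    then show "C \<in> (\<lambda>q. {j\<in>J. \<Phi> j = q}) ` (\<Phi> ` J)" using a(1) by blast
  qed
  then have "finite_index ?G K" unfolding finite_index_def using fin by (meson finite_imageI finite_subset)
  ultimately have "ofi J K" by (simp add: open_finite_index_def)
  then have sub: "sub_residual (Aut E) (Aut_top E) J \<subseteq> K"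
    unfolding sub_residual_def residual_eq by blast
  have "subgroup (sub_residual (Aut E) (Aut_top E) J) ?G"
    unfolding sub_residual_def using J by (intro subgroup_residual group_restrict_Aut topspace_subtopology_Aut)
  then have "enat (card (\<Phi> ` carrier ?G)) \<le> group_index ?G (sub_residual (Aut E) (Aut_top E) J)"
  proof (rule card_image_le_group_index[OF group_restrict_Aut[OF J]])
    fix r x assume "r \<in> sub_residual (Aut E) (Aut_top E) J" "x \<in> carrier ?G"
    then show "\<Phi> (r \<otimes>\<^bsub>?G\<^esub> x) = \<Phi> x" using sub comp[of r x] by (auto simp: K_def)
  qed
  then show ?thesis by (simp add: sub_residual_index_def)
qed

text \<open>Permutations of the cosets are extended by the identity to all sets, so that composition of
  functions is their group law.\<close>

lemma exists_coset_action:
  assumes H: "subgroup H (Aut E)" and N: "ofi H N"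
  obtains \<phi> :: "('v \<Rightarrow> 'v) \<Rightarrow> ('v \<Rightarrow> 'v) set \<Rightarrow> ('v \<Rightarrow> 'v) set" and r
  where "\<And>f g. f \<in> H \<Longrightarrow> g \<in> H \<Longrightarrow> \<phi> (f \<circ> g) = \<phi> f \<circ> \<phi> g"
    and "\<And>h. h \<in> H \<Longrightarrow> agree r h id \<Longrightarrow> \<phi> h = id"
    and "finite (\<phi> ` H)" and "card (cosets H N) \<le> card (\<phi> ` H)"
proof -
  note Hs = subgroup_AutD[OF H]
  define Q where "Q = cosets H N"
  \<comment> \<open>The cosets are right cosets, so a left action must multiply by the inverse on
    the right.\<close>
  define \<phi> where "\<phi> h C = (if C \<in> Q then (\<lambda>x. x \<circ> iv h) ` C else C)" for h C
  have fin: "finite Q" using N by (simp add: open_finite_index_def finite_index_def Q_def)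
  have "subgroup N (Aut E)"
    using N group.incl_subgroup[OF group_Aut H] by (simp add: open_finite_index_def)
  note Ns = subgroup_AutD[OF this]
  have Q: "(\<lambda>x. x \<circ> iv h) ` C \<in> Q" if C: "C \<in> Q" and h: "h \<in> H" for C h
  proof -
    obtain a where "a \<in> H" "C = (\<lambda>n. n \<circ> a) ` N" using C by (auto simp: Q_def cosets_eq)
    then have "(\<lambda>x. x \<circ> iv h) ` C = (\<lambda>n. n \<circ> (a \<circ> iv h)) ` N" "a \<circ> iv h \<in> H"
      using Hs(2,3) h by (simp_all add: image_image comp_assoc)
    then show ?thesis by (auto simp: Q_def cosets_eq)
  qed
  have comp: "\<phi> (f \<circ> g) = \<phi> f \<circ> \<phi> g" if fg: "f \<in> H" "g \<in> H" for f g
  proof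
    fix C
    have "iv (f \<circ> g) = iv g \<circ> iv f" using fg Hs(4) Aut_bij by (intro o_inv_distrib) auto
    then show "\<phi> (f \<circ> g) C = (\<phi> f \<circ> \<phi> g) C"
      using Q[OF _ fg(2)] by (simp add: \<phi>_def image_image comp_assoc)
  qed
  have "\<exists>r. \<forall>h\<in>H. agree r h id \<longrightarrow> (\<lambda>x. x \<circ> iv h) ` C = C" if CQ: "C \<in> Q" for C
  proof -
    obtain a where a: "a \<in> H" "C = (\<lambda>n. n \<circ> a) ` N" using CQ by (auto simp: Q_def cosets_eq)
    have aA: "a \<in> A" using a Hs(4) by blast
    obtain m where m: "iv a \<in> L m" using L_exhaust[OF inv_Aut(1)[OF aA]] by blast
    obtain k where k: "\<And>g. g \<in> H \<Longrightarrow> agree k id g \<Longrightarrow> g \<in> N"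
      using N Ns(1) openin_subtopology_Aut_iff[OF subgroup.subset[OF H], of N]
      unfolding open_finite_index_def by blast
    have "(\<lambda>x. x \<circ> iv h) ` C = C" if h: "h \<in> H" "agree (m + k) h id" for h
    proof -
      \<comment> \<open>The coset of \<open>a\<close> is fixed as soon as this conjugate lies in
        \<open>N\<close>. The summand \<open>m\<close> in the radius pays for the displacement of
        \<open>iv a\<close>.\<close>
      define n where "n = a \<circ> iv h \<circ> iv a"
      have "n \<in> H" unfolding n_def using a h Hs(2,3) by blast
      moreover have "agree k id n"
        unfolding agree_def
      proof
        fix x assume "x \<in> B k p"
        then have "iv a x \<in> B (m + k) p" using m
          by (intro B_trans[of _ _ "iv a p"]) (auto simp: L_def Aut_B)
        then have "h (iv a x) = iv a x" using h(2) by (simp add: agree_def)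
        then have "iv h (iv a x) = iv a x" using iv_apply(2)[OF Hs(4)[OF h(1)], of "iv a x"] by simp
        then show "id x = n x" using aA by (simp add: n_def)
      qed
      ultimately have n: "n \<in> N" by (rule k)
      have na: "a \<circ> iv h = n \<circ> a" using aA by (simp add: fun_eq_iff n_def)
      show ?thesis
      proof (intro subset_antisym subsetI)
        fix y assume "y \<in> (\<lambda>x. x \<circ> iv h) ` C"
        then obtain l where l: "l \<in> N" "y = (l \<circ> a) \<circ> iv h" unfolding a(2) by blast
        have "y = l \<circ> (a \<circ> iv h)" unfolding l(2) by (rule comp_assoc)
        also have "\<dots> = (l \<circ> n) \<circ> a" unfolding na by (rule comp_assoc[symmetric])
        finally have "y = (l \<circ> n) \<circ> a" .
        then show "y \<in> C" unfolding a(2) using Ns(2)[OF l(1) n] by (rule image_eqI)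
      next
        fix y assume "y \<in> C"
        then obtain l where l: "l \<in> N" "y = l \<circ> a" unfolding a(2) by blast
        then have "y = (l \<circ> iv n) \<circ> (n \<circ> a)"
          using iv_apply(2)[OF Ns(4)[OF n]] by (simp add: fun_eq_iff)
        then have "y = ((l \<circ> iv n) \<circ> a) \<circ> iv h"
          unfolding na[symmetric] by (metis comp_assoc)
        then show "y \<in> (\<lambda>x. x \<circ> iv h) ` C" unfolding a(2) using Ns(2)[OF l(1) Ns(3)[OF n]] by blast
      qed
    qed
    then show ?thesis by blast
  qed
  then obtain rr where rr: "\<And>C h. C \<in> Q \<Longrightarrow> h \<in> H \<Longrightarrow> agree (rr C) h id \<Longrightarrow> (\<lambda>x. x \<circ> iv h) ` C = C"
    by metis
  \<comment> \<open>The sum over the finite set \<open>Q\<close> is a common upper bound for the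
    radii of the single cosets.\<close>
  have small: "\<phi> h = id" if h: "h \<in> H" "agree (\<Sum>C\<in>Q. rr C) h id" for h
  proof
    fix C
    have "(\<lambda>x. x \<circ> iv h) ` C = C" if C: "C \<in> Q"
      using rr[OF C h(1) agree_mono[OF _ h(2)]] member_le_sum[OF C _ fin, of rr] by simp
    then show "\<phi> h C = id C" by (simp add: \<phi>_def)
  qed
  have "\<phi> ` H \<subseteq> (\<lambda>f C. if C \<in> Q then f C else C) ` (Q \<rightarrow>\<^sub>E Q)"
  proof
    fix q assume "q \<in> \<phi> ` H"
    then obtain h where h: "h \<in> H" "q = \<phi> h" by auto
    have "q = (\<lambda>C. if C \<in> Q then (restrict (\<phi> h) Q) C else C)"
      unfolding h(2) by (rule ext) (simp add: \<phi>_def)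
    moreover have "restrict (\<phi> h) Q \<in> Q \<rightarrow>\<^sub>E Q" using Q[OF _ h(1)] by (auto simp: \<phi>_def)
    ultimately show "q \<in> (\<lambda>f C. if C \<in> Q then f C else C) ` (Q \<rightarrow>\<^sub>E Q)" by blast
  qed
  then have finite: "finite (\<phi> ` H)" using fin by (meson finite_PiE finite_imageI finite_subset)
  have NQ: "N \<in> Q" using Hs(1) unfolding Q_def cosets_eq by (intro image_eqI[of _ _ id]) auto
  \<comment> \<open>By transitivity, evaluation at the coset \<open>N\<close> maps the permutation
    group onto \<open>Q\<close>.\<close>
  have "Q \<subseteq> (\<lambda>q. q N) ` (\<phi> ` H)"
  proof
    fix C assume "C \<in> Q"
    then obtain a where a: "a \<in> H" "C = (\<lambda>n. n \<circ> a) ` N" by (auto simp: Q_def cosets_eq)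
    have "iv (iv a) = a" using Hs(4)[OF a(1)] Aut_bij by (intro inv_inv_eq) auto
    then have "C = \<phi> (iv a) N" using a NQ by (simp add: \<phi>_def)
    then show "C \<in> (\<lambda>q. q N) ` (\<phi> ` H)" using Hs(3)[OF a(1)] by blast
  qed
  then have "card Q \<le> card (\<phi> ` H)" using finite by (rule surj_card_le[rotated])
  then show thesis using that comp small finite unfolding Q_def by blast
qed

text \<open>The radius is fixed before \<open>J\<close> and \<open>u\<close>, so the bound holds on
  a whole neighbourhood of \<open>H\<close>.\<close>

lemma card_cosets_le_res_index:
  assumes H: "H \<in> S" and \<Gamma>: "subgroup \<Gamma> (Aut E)" "\<Gamma> \<subseteq> H" "cobounded R \<Gamma>" and N: "ofi H N"
  obtains k where "\<And>J u. J \<in> W H k \<Longrightarrow> u \<in> U k \<Longrightarrow> (\<And>g. g \<in> \<Gamma> \<Longrightarrow> u \<circ> g \<circ> iv u \<in> J) \<Longrightarrow>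
    enat (card (cosets H N)) \<le> res_index J"
proof -
  obtain \<phi> :: "('v \<Rightarrow> 'v) \<Rightarrow> ('v \<Rightarrow> 'v) set \<Rightarrow> ('v \<Rightarrow> 'v) set" and r where \<phi>:
    "\<And>f g. f \<in> H \<Longrightarrow> g \<in> H \<Longrightarrow> \<phi> (f \<circ> g) = \<phi> f \<circ> \<phi> g"
    "\<And>h. h \<in> H \<Longrightarrow> agree r h id \<Longrightarrow> \<phi> h = id"
    "finite (\<phi> ` H)" "card (cosets H N) \<le> card (\<phi> ` H)"
    using exists_coset_action[OF SubD(1)[OF H] N] by metis
  define k where "k = r + 8 * R + 2"
  have "enat (card (cosets H N)) \<le> res_index J"
    if J: "J \<in> W H k" and u: "u \<in> U k" "\<And>g. g \<in> \<Gamma> \<Longrightarrow> u \<circ> g \<circ> iv u \<in> J" for J u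
  proof -
    have JS: "subgroup J (Aut E)" using J SubD(1) by (auto simp: W_def)
    have W: "\<exists>h\<in>H. agree k h j" if "j \<in> J" "j \<in> L k" for j
      using J that unfolding W_def by blast
    have W': "\<exists>j\<in>J. agree k j h" if "h \<in> H" "h \<in> L k" for h
      using J that unfolding W_def by blast
    have "hom_transfer E p H J \<Gamma> R r k u \<phi>"
      by (rule hom_transfer.intro[OF lf_graph_axioms], rule hom_transfer_axioms.intro)
        (use SubD(1)[OF H] JS \<Gamma> \<phi>(1,2) W W' u in \<open>simp_all add: k_def\<close>)
    then interpret hom_transfer E p H J \<Gamma> R r k u \<phi> .
    have "enat (card (\<Phi> ` J)) \<le> res_index J"
      using \<phi>(3) by (intro card_image_le_res_index[OF JS \<Phi>_comp \<Phi>_small]) (simp_all add: \<Phi>_image)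
    then have "enat (card (\<phi> ` H)) \<le> res_index J" by (simp add: \<Phi>_image)
    then show ?thesis using \<phi>(4) by (meson enat_ord_simps(1) order_trans)
  qed
  then show thesis using that by blast
qed

section \<open>Conjugates\<close>

lemma cobounded_of_acts_cocompactly:
  assumes \<Gamma>: "subgroup \<Gamma> (Aut E)" and "acts_cocompactly \<Gamma> E"
  obtains R where "cobounded R \<Gamma>"
proof -
  define O' where "O' v = orbit (Aut E\<lparr>carrier := \<Gamma>\<rparr>) (\<lambda>g. g) v" for v
  have O': "w \<in> O' v \<longleftrightarrow> (\<exists>g\<in>\<Gamma>. w = g v)" for v w by (auto simp: O'_def orbit_def)
  have "finite (range O')"
    using assms(2) by (simp add: acts_cocompactly_def orbits_def O'_def full_SetCompr_eq)
  \<comment> \<open>One representative per orbit gives a finite set, which fits in a ball. Moving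
    both vertices into it yields the constant \<open>n + n\<close>.\<close>
  then obtain n where n: "(\<lambda>C. SOME x. x \<in> C) ` range O' \<subseteq> B n p" using finite_subset_B by blast
  have rep: "\<exists>g\<in>\<Gamma>. g v \<in> B n p" for v
  proof -
    have "v \<in> O' v" using O' subgroup_AutD(1)[OF \<Gamma>] by force
    then have "(SOME x. x \<in> O' v) \<in> O' v" by (rule someI)
    then obtain g where g: "g \<in> \<Gamma>" "(SOME x. x \<in> O' v) = g v" using O'[of _ v] by auto
    have "(SOME x. x \<in> O' v) \<in> B n p" using n by blast
    then show ?thesis using g by auto
  qed
  have "\<exists>g\<in>\<Gamma>. g w \<in> B (n + n) v" for v w
  proof -
    obtain g h where gh: "g \<in> \<Gamma>" "g v \<in> B n p" "h \<in> \<Gamma>" "h w \<in> B n p" using rep by meson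
    have "h w \<in> B (n + n) (g v)" using gh(4) B_sym[OF gh(2)] by (rule B_trans)
    then have "(iv g \<circ> h) w \<in> B (n + n) v"
      using subgroup_AutD(4)[OF \<Gamma> gh(1)] by (simp add: Aut_iv_B)
    then show ?thesis using gh subgroup_AutD(2,3)[OF \<Gamma>] by blast
  qed
  then show thesis using that unfolding cobounded_def by blast
qed

lemma cobounded_conj:
  assumes "cobounded R \<Gamma>" "t \<in> A"
  shows "cobounded R ((\<lambda>g. t \<circ> g \<circ> iv t) ` \<Gamma>)"
  unfolding cobounded_def
proof (intro allI)
  fix v w
  obtain g where g: "g \<in> \<Gamma>" "g (iv t w) \<in> B R (iv t v)" using assms(1) unfolding cobounded_def by blast
  then have "t (g (iv t w)) \<in> B R v" using Aut_B[OF assms(2), of "g (iv t w)" R "iv t v"] assms(2) by simp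
  then show "\<exists>f\<in>(\<lambda>g. t \<circ> g \<circ> iv t) ` \<Gamma>. f w \<in> B R v" using g(1) by auto
qed

lemma subgroup_conj:
  assumes \<Gamma>: "subgroup \<Gamma> (Aut E)" and t: "t \<in> A"
  shows "subgroup ((\<lambda>g. t \<circ> g \<circ> iv t) ` \<Gamma>) (Aut E)"
proof (rule subgroup.intro)
  note Gs = subgroup_AutD[OF \<Gamma>]
  let ?C = "(\<lambda>g. t \<circ> g \<circ> iv t) ` \<Gamma>"
  show sub: "?C \<subseteq> A" using Gs(4) t by (auto intro!: comp_Aut inv_Aut(1))
  show "\<one>\<^bsub>Aut E\<^esub> \<in> ?C" using Gs(1) t by (intro image_eqI[of _ _ id]) simp_all
  show "x \<otimes>\<^bsub>Aut E\<^esub> y \<in> ?C" if xy: "x \<in> ?C" "y \<in> ?C" for x y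
  proof -
    obtain f g where fg: "f \<in> \<Gamma>" "x = t \<circ> f \<circ> iv t" "g \<in> \<Gamma>" "y = t \<circ> g \<circ> iv t" using xy by auto
    then have "x \<circ> y = t \<circ> (f \<circ> g) \<circ> iv t" using t by (simp add: fun_eq_iff)
    then show ?thesis using Gs(2)[OF fg(1,3)] by simp
  qed
  show "inv\<^bsub>Aut E\<^esub> x \<in> ?C" if x: "x \<in> ?C" for x
  proof -
    obtain g where g: "g \<in> \<Gamma>" "x = t \<circ> g \<circ> iv t" using x by auto
    have A: "t \<circ> iv g \<circ> iv t \<in> A" using Gs(3)[OF g(1)] sub by blast
    have "(t \<circ> iv g \<circ> iv t) \<otimes>\<^bsub>Aut E\<^esub> x = \<one>\<^bsub>Aut E\<^esub>"
      using t Gs(4)[OF g(1)] unfolding g(2) by (simp add: fun_eq_iff)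
    then have "inv\<^bsub>Aut E\<^esub> x = t \<circ> iv g \<circ> iv t"
      using A x sub by (intro group.inv_equality[OF group_Aut]) auto
    then show ?thesis using Gs(3)[OF g(1)] by blast
  qed
qed

text \<open>\<open>iv t\<close> takes \<open>B k p\<close> into \<open>B (m + k) p\<close>, and
  \<open>g\<close> takes that into \<open>B (l + (m + k)) p\<close>. On this ball \<open>t\<close>
  and \<open>t'\<close> coincide, which also forces \<open>iv t' x = iv t x\<close>.\<close>

lemma agree_conj:
  assumes "t \<in> L m" "t' \<in> A" "g \<in> L l" "agree (l + (m + k)) t t'"
  shows "agree k (t \<circ> g \<circ> iv t) (t' \<circ> g \<circ> iv t')"
  unfolding agree_def
proof
  fix x assume x: "x \<in> B k p"
  have t: "t \<in> A" "iv t \<in> A" "iv t \<in> L m" and g: "g \<in> A"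
    using assms L_iv inv_Aut(1) by (auto simp: L_def)
  have y: "iv t x \<in> B (m + k) p"
    using t x by (intro B_trans[of _ _ "iv t p"]) (auto simp: L_def Aut_B)
  have "g (iv t x) \<in> B (l + (m + k)) p"
    using assms(3) g y by (intro B_trans[of _ "m + k" "g p"]) (auto simp: L_def Aut_B)
  then have 1: "t (g (iv t x)) = t' (g (iv t x))" using assms(4) by (simp add: agree_def)
  have "t' (iv t x) = x"
    using assms(4) B_mono[OF _ y, of "l + (m + k)"] iv_apply(1)[OF t(1), of x]
    by (simp add: agree_def del: iv_apply)
  then have "iv t' x = iv t x" using iv_apply(2)[OF assms(2), of "iv t x"] by simp
  with 1 show "(t \<circ> g \<circ> iv t) x = (t' \<circ> g \<circ> iv t') x" by simp
qed

section \<open>Semicontinuity along a convergent sequence\<close>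

lemma res_index_le_limsup:
  assumes \<Gamma>: "subgroup \<Gamma> (Aut E)" "cobounded R \<Gamma>"
    and lim: "limitin (chabauty (Aut E) (Aut_top E)) Hs H sequentially"
    and Hs: "\<And>n::nat. n \<ge> 1 \<Longrightarrow> Hs n \<in> S"
    and \<tau>: "\<And>n. n \<ge> 1 \<Longrightarrow> \<exists>\<tau>\<in>A. \<forall>g\<in>\<Gamma>. \<tau> \<circ> g \<circ> iv \<tau> \<in> Hs n"
  shows "res_index H \<le> limsup (\<lambda>n. res_index (Hs n))"
proof -
  note Gs = subgroup_AutD[OF \<Gamma>(1)]
  have H: "H \<in> S" and W: "\<forall>\<^sub>F n in sequentially. Hs n \<in> W H k" for k
    using limitin_chabautyD[OF lim] by auto
  \<comment> \<open>Multiplying the conjugator on the right by an element of \<open>\<Gamma>\<close>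
    does not change the conjugate of \<open>\<Gamma>\<close>, and cobounded orbits bring its
    displacement below \<open>R\<close>.\<close>
  have "\<exists>s\<in>L R. \<forall>g\<in>\<Gamma>. s \<circ> g \<circ> iv s \<in> Hs n" if n: "n \<ge> 1" for n
  proof -
    obtain t where t: "t \<in> A" "\<And>g. g \<in> \<Gamma> \<Longrightarrow> t \<circ> g \<circ> iv t \<in> Hs n" using \<tau>[OF n] by blast
    obtain f where f: "f \<in> \<Gamma>" "f p \<in> B R (iv t p)" using \<Gamma>(2) unfolding cobounded_def by blast
    have fA: "f \<in> A" using f Gs(4) by blast
    have "t (f p) \<in> B R p" using Aut_B[OF t(1), of "f p" R "iv t p"] f(2) t(1) by simp
    then have "t \<circ> f \<in> L R" using t fA by (simp add: L_def comp_Aut)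
    moreover have "(t \<circ> f) \<circ> g \<circ> iv (t \<circ> f) \<in> Hs n" if "g \<in> \<Gamma>" for g
    proof -
      have "iv (t \<circ> f) = iv f \<circ> iv t" using t(1) fA Aut_bij by (intro o_inv_distrib) auto
      then have "(t \<circ> f) \<circ> g \<circ> iv (t \<circ> f) = t \<circ> (f \<circ> g \<circ> iv f) \<circ> iv t" by (simp add: comp_assoc)
      then show ?thesis using t(2)[of "f \<circ> g \<circ> iv f"] f(1) that Gs(2,3) by simp
    qed
    ultimately show ?thesis by blast
  qed
  then obtain s where s: "\<And>n. n \<ge> 1 \<Longrightarrow> s n \<in> L R"
    "\<And>n g. n \<ge> 1 \<Longrightarrow> g \<in> \<Gamma> \<Longrightarrow> s n \<circ> g \<circ> iv (s n) \<in> Hs n" by metis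
  then obtain t where t: "t \<in> L R" and freq: "\<And>k. \<exists>\<^sub>F n in sequentially. agree k t (s n)"
    using exists_cluster_point[of s R] by blast
  have tA: "t \<in> A" using t by (simp add: L_def)
  \<comment> \<open>Agreement with \<open>t\<close> is only frequent, closeness to \<open>H\<close>
    eventual; together they hold at arbitrarily large \<open>n\<close>.\<close>
  have ex: "\<exists>n\<ge>N. n \<ge> 1 \<and> agree m t (s n) \<and> Hs n \<in> W H k" for N m k
  proof -
    have "\<exists>\<^sub>F n in sequentially. (Hs n \<in> W H k \<and> max N 1 \<le> n) \<and> agree m t (s n)"
      by (intro frequently_eventually_conj eventually_conj freq W eventually_ge_at_top)
    then show ?thesis by (auto dest!: frequently_ex)
  qed
  define \<Delta> where "\<Delta> = (\<lambda>g. t \<circ> g \<circ> iv t) ` \<Gamma>"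
  have \<Delta>: "subgroup \<Delta> (Aut E)" "cobounded R \<Delta>"
    unfolding \<Delta>_def using subgroup_conj[OF \<Gamma>(1) tA] cobounded_conj[OF \<Gamma>(2) tA] by auto
  \<comment> \<open>As \<open>H\<close> is closed, approximating \<open>f\<close> suffices: by a
    conjugate in \<open>Hs n\<close>, and that by an element of \<open>H\<close>. Adding the
    displacement \<open>m\<close> of \<open>f\<close> to the radius puts the conjugate into the test
    set.\<close>
  have "\<Delta> \<subseteq> H"
  proof
    fix f assume f: "f \<in> \<Delta>"
    then obtain g where g: "g \<in> \<Gamma>" "f = t \<circ> g \<circ> iv t" by (auto simp: \<Delta>_def)
    have fA: "f \<in> A" using f \<Delta>(1) subgroup.subset by blast
    obtain l where l: "g \<in> L l" using L_exhaust Gs(4) g by blast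
    obtain m where m: "f \<in> L m" using L_exhaust fA by blast
    show "f \<in> H"
    proof (rule closedin_AutD[OF SubD(2)[OF H] fA])
      fix k
      obtain n where n: "n \<ge> 1" "agree (l + (R + (k + m))) t (s n)" "Hs n \<in> W H (k + m)"
        using ex by blast
      let ?f = "s n \<circ> g \<circ> iv (s n)"
      have "s n \<in> A" using s(1)[OF n(1)] by (simp add: L_def)
      then have ff: "agree (k + m) f ?f" unfolding g(2) using n(2) by (intro agree_conj[OF t _ l])
      have fH: "?f \<in> Hs n" using s(2) n(1) g(1) by blast
      have "?f \<in> A" using fH SubD(1)[OF Hs[OF n(1)]] subgroup.subset by blast
      then have "?f \<in> L (k + m)" using L_mono[OF _ L_agree[OF ff m]] by simp
      then obtain h where h: "h \<in> H" "agree (k + m) h ?f" using n(3) fH unfolding W_def by blast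
      then have "agree (k + m) f h" using ff agree_trans agree_sym by blast
      then show "\<exists>h\<in>H. agree k f h" using h(1) agree_mono[of k "k + m"] by auto
    qed
  qed
  have "enat (card (cosets H N)) \<le> limsup (\<lambda>n. res_index (Hs n))" if N: "ofi H N" for N
  proof -
    obtain k where k: "\<And>J u. J \<in> W H k \<Longrightarrow> u \<in> U k \<Longrightarrow> (\<And>g. g \<in> \<Delta> \<Longrightarrow> u \<circ> g \<circ> iv u \<in> J) \<Longrightarrow>
        enat (card (cosets H N)) \<le> res_index J"
      using card_cosets_le_res_index[OF H \<Delta>(1) \<open>\<Delta> \<subseteq> H\<close> \<Delta>(2) N] by blast
    have "\<exists>n\<ge>M. enat (card (cosets H N)) \<le> res_index (Hs n)" for M
    proof -
      obtain n where n: "n \<ge> M" "n \<ge> 1" "agree (R + k) t (s n)" "Hs n \<in> W H k" using ex by blast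
      have sA: "s n \<in> A" using s(1)[OF n(2)] by (simp add: L_def)
      \<comment> \<open>This carries the limit conjugate \<open>\<Delta>\<close> to the one in
        \<open>Hs n\<close>. Since \<open>iv t\<close> moves \<open>p\<close> by at most
        \<open>R\<close>, agreement of \<open>s n\<close> with \<open>t\<close> up to
        \<open>R + k\<close> makes \<open>u\<close> fix \<open>B k p\<close>.\<close>
      define u where "u = s n \<circ> iv t"
      have "agree k (s n \<circ> iv t) (t \<circ> iv t)"
      proof -
        have "agree (k + R) (s n) t" using agree_sym[OF n(3)] by (simp add: add.commute)
        then show ?thesis by (rule agree_comp) (use L_iv[OF t] in simp_all)
      qed
      then have uU: "u \<in> U k" unfolding U_def u_def using sA tA by (simp add: comp_Aut inv_Aut(1))
      have "iv u = iv (iv t) \<circ> iv (s n)"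
        unfolding u_def using sA inv_Aut(1)[OF tA] Aut_bij by (intro o_inv_distrib) auto
      then have ivu: "iv u = t \<circ> iv (s n)" by (simp only: inv_inv_eq[OF Aut_bij[OF tA]])
      have "u \<circ> f \<circ> iv u \<in> Hs n" if f: "f \<in> \<Delta>" for f
      proof -
        obtain g where g: "g \<in> \<Gamma>" "f = t \<circ> g \<circ> iv t" using f by (auto simp: \<Delta>_def)
        have "u \<circ> f \<circ> iv u = s n \<circ> g \<circ> iv (s n)"
          unfolding ivu unfolding g(2) u_def using tA by (simp add: fun_eq_iff)
        then show ?thesis using s(2)[OF n(2) g(1)] by simp
      qed
      then show ?thesis using k[OF n(4) uU] n(1) by blast
    qed
    then show ?thesis
      unfolding limsup_INF_SUP by (intro INF_greatest) (meson SUP_upper2 atLeast_iff)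
  qed
  then show ?thesis
    unfolding sub_residual_index_def sub_residual_def
    using group_restrict_Aut[OF SubD(1)[OF H]] topspace_subtopology_Aut[OF SubD(1)[OF H]]
    by (intro group_index_residual_le)
qed

section \<open>Closedness of the set of overgroups equal to their residual\<close>

lemma closedin_residual_eq:
  assumes \<Gamma>: "subgroup \<Gamma> (Aut E)" "cobounded R \<Gamma>"
  shows "closedin (chabauty (Aut E) (Aut_top E))
    {H \<in> S. \<Gamma> \<subseteq> H \<and> H = sub_residual (Aut E) (Aut_top E) H}" (is "closedin _ ?C")
  unfolding closedin_def topspace_chabauty
proof (intro conjI chabauty_openI)
  fix H assume H: "H \<in> S - ?C"
  then have HS: "H \<in> S" by blast
  show "\<exists>k. W H k \<subseteq> S - ?C"
  proof (cases "\<Gamma> \<subseteq> H")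
    case False
    then obtain g where g: "g \<in> \<Gamma>" "g \<notin> H" by blast
    then have gA: "g \<in> A" using subgroup_AutD(4)[OF \<Gamma>(1)] by blast
    then obtain m where m: "g \<in> L m" using L_exhaust by blast
    \<comment> \<open>As \<open>H\<close> is closed, some radius separates \<open>g\<close> from it;
      enlarging it by the displacement of \<open>g\<close> lets nearby subgroups detect
      this.\<close>
    obtain k where k: "\<And>h. h \<in> H \<Longrightarrow> \<not> agree k g h"
      using closedin_AutD[OF SubD(2)[OF HS] gA] g(2) by blast
    have "\<not> \<Gamma> \<subseteq> J" if J: "J \<in> W H (k + m)" for J
    proof
      assume "\<Gamma> \<subseteq> J"
      then have "g \<in> J \<inter> L (k + m)" using g(1) L_mono[OF _ m, of "k + m"] by auto
      then obtain h where "h \<in> H" "agree (k + m) h g" using J unfolding W_def by blast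
      then show False using k agree_sym agree_mono[of k "k + m" h g] by auto
    qed
    then show ?thesis by (intro exI[of _ "k + m"]) (auto simp: W_def)
  next
    case True
    let ?G = "Aut E\<lparr>carrier := H\<rparr>"
    note G = group_restrict_Aut[OF SubD(1)[OF HS]] topspace_subtopology_Aut[OF SubD(1)[OF HS]]
    have "H \<noteq> sub_residual (Aut E) (Aut_top E) H" using H True by blast
    moreover have "sub_residual (Aut E) (Aut_top E) H \<subseteq> H"
      unfolding sub_residual_def using subgroup.subset[OF subgroup_residual[OF G]] by simp
    ultimately obtain N where N: "ofi H N" "\<not> H \<subseteq> N"
      unfolding sub_residual_def residual_eq by blast
    have "card (cosets H N) \<noteq> 1"
    proof
      assume 1: "card (cosets H N) = 1"
      have sub: "subgroup N ?G" using N(1) by (simp add: open_finite_index_def)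
      have "N = carrier ?G"
      proof (rule group.subgroup_eq_of_card_rcosets_le[OF G(1) sub])
        show "subgroup (carrier ?G) ?G" using G(1) by (rule group.subgroup_self)
        show "N \<subseteq> carrier ?G" using sub by (rule subgroup.subset)
        show "finite_index ?G N" using N(1) by (simp add: open_finite_index_def)
        show "card (cosets H N) \<le> card (cosets H (carrier ?G))"
          using group_index_eq_enatD(2)[of ?G "carrier ?G" 1] group.group_index_carrier[OF G(1)] 1
          by (simp add: one_enat_def)
      qed
      then show False using N(2) by simp
    qed
    \<comment> \<open>\<open>card\<close> is 0 on infinite sets as well, so finiteness of the index
      enters here.\<close>
    moreover have "card (cosets H N) \<noteq> 0"
    proof -
      have "H \<noteq> {}" using subgroup_AutD(1)[OF SubD(1)[OF HS]] by blast
      then show ?thesis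
        using N(1) by (auto simp: open_finite_index_def finite_index_def cosets_eq)
    qed
    ultimately have "1 < enat (card (cosets H N))" by (simp add: one_enat_def)
    moreover obtain k where k: "\<And>J u. J \<in> W H k \<Longrightarrow> u \<in> U k \<Longrightarrow> (\<And>g. g \<in> \<Gamma> \<Longrightarrow> u \<circ> g \<circ> iv u \<in> J) \<Longrightarrow>
        enat (card (cosets H N)) \<le> res_index J"
      using card_cosets_le_res_index[OF HS \<Gamma>(1) True \<Gamma>(2) N(1)] by blast
    have "J \<notin> ?C" if J: "J \<in> W H k" for J
    proof
      assume C: "J \<in> ?C"
      \<comment> \<open>\<open>J\<close> would contain \<open>\<Gamma>\<close> itself, so the
        conjugator is trivial; being its own residual gives \<open>J\<close> index 1, against the
        bound.\<close>
      have "id \<in> U k" using L_id by (simp add: U_def L_def)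
      moreover have "id \<circ> g \<circ> iv id \<in> J" if "g \<in> \<Gamma>" for g using C that by auto
      ultimately have "enat (card (cosets H N)) \<le> res_index J" by (rule k[OF J])
      moreover have "res_index J = 1"
      proof -
        have "group_index (Aut E\<lparr>carrier := J\<rparr>) (carrier (Aut E\<lparr>carrier := J\<rparr>)) = 1"
          using C SubD(1) by (intro group.group_index_carrier group_restrict_Aut) blast
        then show ?thesis using C by (simp add: sub_residual_index_def)
      qed
      ultimately show False using \<open>1 < enat (card (cosets H N))\<close> by simp
    qed
    then show ?thesis by (intro exI[of _ k]) (auto simp: W_def)
  qed
qed auto

end

theorem theorem1p3:
  fixes E :: "'v \<Rightarrow> 'v \<Rightarrow> bool" and \<Gamma> :: "('v \<Rightarrow> 'v) set"
  assumes "simple_graph E" and "locally_finite_graph E" and "connected_graph E"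
    and "subgroup \<Gamma> (Aut E)" and "acts_cocompactly \<Gamma> E"
  shows "(\<forall>(Hs :: nat \<Rightarrow> ('v \<Rightarrow> 'v) set) H.
            (\<forall>n\<ge>1. Hs n \<in> Sub (Aut E) (Aut_top E)) \<longrightarrow>
            limitin (chabauty (Aut E) (Aut_top E)) Hs H sequentially \<longrightarrow>
            (\<forall>n\<ge>1. \<exists>\<tau>\<in>carrier (Aut E).
               (\<lambda>\<gamma>. \<tau> \<otimes>\<^bsub>Aut E\<^esub> \<gamma> \<otimes>\<^bsub>Aut E\<^esub> inv\<^bsub>Aut E\<^esub> \<tau>) ` \<Gamma> \<subseteq> Hs n) \<longrightarrow>
            sub_residual_index (Aut E) (Aut_top E) H
              \<le> limsup (\<lambda>n. sub_residual_index (Aut E) (Aut_top E) (Hs n)))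
       \<and> closedin (chabauty (Aut E) (Aut_top E))
           {H \<in> Sub (Aut E) (Aut_top E). \<Gamma> \<subseteq> H \<and> H = sub_residual (Aut E) (Aut_top E) H}"
proof -
  \<comment> \<open>Any vertex serves as base point, and a type is inhabited.\<close>
  interpret lf_graph E undefined
    using assms(1-3)
    by unfold_locales (auto simp: simple_graph_def locally_finite_graph_def connected_graph_def symp_def)
  obtain R where R: "cobounded R \<Gamma>" using cobounded_of_acts_cocompactly[OF assms(4,5)] .
  show ?thesis
  proof (intro conjI allI impI)
    fix Hs :: "nat \<Rightarrow> ('v \<Rightarrow> 'v) set" and H
    assume Hs: "\<forall>n\<ge>1. Hs n \<in> Sub (Aut E) (Aut_top E)"
      and lim: "limitin (chabauty (Aut E) (Aut_top E)) Hs H sequentially"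
      and \<tau>: "\<forall>n\<ge>1. \<exists>\<tau>\<in>carrier (Aut E).
               (\<lambda>\<gamma>. \<tau> \<otimes>\<^bsub>Aut E\<^esub> \<gamma> \<otimes>\<^bsub>Aut E\<^esub> inv\<^bsub>Aut E\<^esub> \<tau>) ` \<Gamma> \<subseteq> Hs n"
    show "res_index H \<le> limsup (\<lambda>n. res_index (Hs n))"
    proof (rule res_index_le_limsup[OF assms(4) R lim])
      fix n :: nat assume n: "n \<ge> 1"
      show "Hs n \<in> S" using Hs n by blast
      obtain t where "t \<in> A" "(\<lambda>\<gamma>. t \<otimes>\<^bsub>Aut E\<^esub> \<gamma> \<otimes>\<^bsub>Aut E\<^esub> inv\<^bsub>Aut E\<^esub> t) ` \<Gamma> \<subseteq> Hs n"
        using \<tau> n by blast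
      then show "\<exists>\<tau>\<in>A. \<forall>g\<in>\<Gamma>. \<tau> \<circ> g \<circ> iv \<tau> \<in> Hs n"
        by (intro bexI[of _ t]) (auto simp: inv_Aut(2))
    qed
  qed (rule closedin_residual_eq[OF assms(4) R])
qed

end
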